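(* Let $\mathcal{H}$ be an infinite-dimensional complex reproducing kernel Hilbert space of functions on a set $X$, with kernels $k_a$ ($a\in X$), such that $k_a\ne 0$ for every $a\in X$ and $\{k_a,k_b\}$ is linearly independent whenever $a\neq b$. For $a\in X$ let $\mathcal{Z}_a=\{f\in\mathcal{H}:f(a)=0\}$ and let $P_{\mathcal{Z}_a}$ be the orthogonal projection onto $\mathcal{Z}_a$. Then, for all $a,b\in X$, the metrics $\Gamma,\delta,\hat\delta,\check\delta$ on $X$ defined in the context satisfy: 1. $\check\delta(a,b)=\Gamma(a,b)$; 2. $\delta(a,b)=\sin(\Gamma(a,b))=\|P_{\mathcal{Z}_a}-P_{\mathcal{Z}_b}\|=2^{-1/p}\|P_{\mathcal{Z}_a}-P_{\mathcal{Z}_b}\|_p$ for every $1\le p<\infty$; 3. $\hat\delta(a,b)=\sqrt{2}\,\sin\left(\tfrac12\Gamma(a,b)\right)$.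
   Context: The kernel $k_w\in\mathcal{H}$ satisfies $f(w)=\langle f,k_w\rangle$ for all $f\in\mathcal{H}$. $\|\cdot\|$ is the operator norm and $\|\cdot\|_p$ the Schatten $p$-norm. $\mathrm{Gr}(\mathcal{H})$ is the Grassmann manifold of closed subspaces of $\mathcal{H}$, identified with the set of orthogonal projections in $\mathcal{B}(\mathcal{H})$. The length of a piecewise smooth curve of projections $\gamma:[0,1]\to\mathrm{Gr}(\mathcal{H})$ is $\int_0^1\|\dot\gamma(t)\|\,dt$, and $d(\mathcal{S},\mathcal{T})$ is the infimum of the lengths of piecewise smooth curves in $\mathrm{Gr}(\mathcal{H})$ joining $\mathcal{S}$ and $\mathcal{T}$. Define $\Gamma(a,b)=d(\mathcal{Z}_a,\mathcal{Z}_b)$. Define $$\delta(a,b)=\sqrt{1-\left(\frac{|\langle k_a,k_b\rangle|}{\|k_a\|\|k_b\|}\right)^2},\qquad \hat\delta(a,b)=\sqrt{1-\frac{|\langle k_a,k_b\rangle|}{\|k_a\|\|k_b\|}}.$$ Let $S(\mathcal{H})$ be the unit sphere of $\mathcal{H}$ and $P(\mathcal{H})=S(\mathcal{H})/\sim$ the projective space, where $f\sim g$ iff $f=\lambda g$ for some $\lambda\in\mathbb{C}$ with $|\lambda|=1$; $[f]$ denotes the class of $f$. The length of a piecewise smooth curve $\gamma:[0,1]\to P(\mathcal{H})$ is $$L(\gamma)=\int_0^1\left(\|\dot{\tilde\gamma}(t)\|^2-|\langle\dot{\tilde\gamma}(t),\tilde\gamma(t)\rangle|^2\right)^{1/2}dt,$$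 where $\tilde\gamma:[0,1]\to S(\mathcal{H})$ is any piecewise smooth lift of $\gamma$, i.e. $[\tilde\gamma(t)]=\gamma(t)$. Define $\check\delta(a,b)$ as the infimum of $L(\gamma)$ over all piecewise smooth curves $\gamma$ in $P(\mathcal{H})$ joining $\left[\frac{k_a}{\|k_a\|}\right]$ and $\left[\frac{k_b}{\|k_b\|}\right]$. *)

theory Defs
  imports "HOL-Analysis.Analysis"
begin

section \<open>Complex Hilbert spaces\<close>

text \<open>
  The real inner product of the superclass is the real part of the complex one, so the norm is
  \<open>\<parallel>x\<parallel> = sqrt \<langle>x, x\<rangle>\<close>. The complex inner product is linear in its first argument.
\<close>

class complex_inner_space = real_inner +
  fixes scaleC :: "complex \<Rightarrow> 'a \<Rightarrow> 'a"  (infixr \<open>*\<^sub>C\<close> 75)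
    and cinner :: "'a \<Rightarrow> 'a \<Rightarrow> complex"
  assumes scaleC_add_right: "c *\<^sub>C (x + y) = c *\<^sub>C x + c *\<^sub>C y"
    and scaleC_add_left: "(c + d) *\<^sub>C x = c *\<^sub>C x + d *\<^sub>C x"
    and scaleC_scaleC: "c *\<^sub>C (d *\<^sub>C x) = (c * d) *\<^sub>C x"
    and scaleR_eq_scaleC: "r *\<^sub>R x = complex_of_real r *\<^sub>C x"
    and cinner_commute: "cinner x y = cnj (cinner y x)"
    and cinner_add_left: "cinner (x + y) z = cinner x z + cinner y z"
    and cinner_scaleC_left: "cinner (c *\<^sub>C x) y = c * cinner x y"
    and inner_eq_Re_cinner: "inner x y = Re (cinner x y)"

class complex_hilbert_space = complex_inner_space + complete_space

global_interpretation complex_vector: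
  vector_space "scaleC :: complex \<Rightarrow> 'a \<Rightarrow> 'a :: complex_inner_space"
  defines cdependent = complex_vector.dependent
    and cspan = complex_vector.span
    and cdim = complex_vector.dim
proof
  fix x :: 'a
  show "1 *\<^sub>C x = x"
    using scaleR_eq_scaleC[of 1 x] by simp
qed (simp_all add: scaleC_add_right scaleC_add_left scaleC_scaleC)


section \<open>Reproducing kernel Hilbert spaces\<close>

text \<open>
  A Hilbert space of functions on \<open>'x\<close> is a Hilbert space \<open>'h\<close> together with the linear embedding
  \<open>ev\<close> that sends each element to the function it is. The reproducing property makes every point
  evaluation bounded.
\<close>

definition rkhs ::
  "('h::complex_hilbert_space \<Rightarrow> 'x \<Rightarrow> complex) \<Rightarrow> ('x \<Rightarrow> 'h) \<Rightarrow> bool" where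
  "rkhs ev k \<longleftrightarrow>
     inj ev \<and>
     (\<forall>f g x. ev (f + g) x = ev f x + ev g x) \<and>
     (\<forall>c f x. ev (c *\<^sub>C f) x = c * ev f x) \<and>
     (\<forall>f w. ev f w = cinner f (k w))"

definition zero_space :: "('h::complex_hilbert_space \<Rightarrow> 'x \<Rightarrow> complex) \<Rightarrow> 'x \<Rightarrow> 'h set" where
  "zero_space ev a = {f. ev f a = 0}"

definition delta :: "('x \<Rightarrow> 'h::complex_hilbert_space) \<Rightarrow> 'x \<Rightarrow> 'x \<Rightarrow> real" where
  "delta k a b = sqrt (1 - (cmod (cinner (k a) (k b)) / (norm (k a) * norm (k b)))\<^sup>2)"

definition delta_hat :: "('x \<Rightarrow> 'h::complex_hilbert_space) \<Rightarrow> 'x \<Rightarrow> 'x \<Rightarrow> real" where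
  "delta_hat k a b = sqrt (1 - cmod (cinner (k a) (k b)) / (norm (k a) * norm (k b)))"


section \<open>Operators\<close>

text \<open>
  An element of the algebra of bounded operators is a complex linear element of the type
  \<open>'h \<Rightarrow>\<^sub>L 'h\<close> of bounded real linear maps; \<open>norm\<close> on this type is the operator norm.
\<close>

definition complex_linear :: "('h::complex_hilbert_space \<Rightarrow>\<^sub>L 'h) \<Rightarrow> bool" where
  "complex_linear T \<longleftrightarrow> (\<forall>c x. T (c *\<^sub>C x) = c *\<^sub>C T x)"

definition cadjoint :: "('h::complex_hilbert_space \<Rightarrow>\<^sub>L 'h) \<Rightarrow> ('h \<Rightarrow>\<^sub>L 'h)" where
  "cadjoint T = (THE S :: 'h \<Rightarrow>\<^sub>L 'h. \<forall>x y. cinner (T x) y = cinner x (S y))"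

definition orthogonal_projection :: "('h::complex_hilbert_space \<Rightarrow>\<^sub>L 'h) \<Rightarrow> bool" where
  "orthogonal_projection P \<longleftrightarrow>
     complex_linear P \<and> P o\<^sub>L P = P \<and> (\<forall>x y. cinner (P x) y = cinner x (P y))"

definition projection_onto :: "'h::complex_hilbert_space set \<Rightarrow> ('h \<Rightarrow>\<^sub>L 'h)" where
  "projection_onto S = (THE P. orthogonal_projection P \<and> range (blinfun_apply P) = S)"

definition compact_operator :: "('h::complex_hilbert_space \<Rightarrow>\<^sub>L 'h) \<Rightarrow> bool" where
  "compact_operator T \<longleftrightarrow> complex_linear T \<and> compact (closure (blinfun_apply T ` cball 0 1))"

text \<open>
  The singular values of a compact operator \<open>T\<close> are the square roots \<open>s\<close> of the eigenvalues of
  \<open>T\<^sup>* T\<close>; the multiplicity of \<open>s\<close> is the dimension of the corresponding eigenspace, which is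
  finite when \<open>s > 0\<close>. Summing over all \<open>s > 0\<close>, weighted by multiplicity, gives the sum over the
  sequence of singular values, as numbers \<open>s\<close> that are not singular values have multiplicity 0.
\<close>

definition singular_multiplicity :: "('h::complex_hilbert_space \<Rightarrow>\<^sub>L 'h) \<Rightarrow> real \<Rightarrow> nat" where
  "singular_multiplicity T s = cdim {x. (cadjoint T o\<^sub>L T) x = s\<^sup>2 *\<^sub>R x}"

definition schatten_class :: "real \<Rightarrow> ('h::complex_hilbert_space \<Rightarrow>\<^sub>L 'h) set" where
  "schatten_class p = {T. compact_operator T \<and>
     (\<lambda>s. real (singular_multiplicity T s) * s powr p) summable_on {0<..}}"

text \<open>The value of the Schatten norm is meaningful only on \<open>schatten_class p\<close>.\<close>

definition schatten_norm :: "real \<Rightarrow> ('h::complex_hilbert_space \<Rightarrow>\<^sub>L 'h) \<Rightarrow> real" where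
  "schatten_norm p T =
     (\<Sum>\<^sub>\<infinity>s\<in>{0<..}. real (singular_multiplicity T s) * s powr p) powr (1 / p)"


section \<open>Piecewise smooth curves\<close>

text \<open>
  \<open>D n\<close> is the \<open>n\<close>-th derivative, one-sided at the end points. Smoothness is required on the closed
  pieces: without one-sided derivatives at the break points (as in
  \<open>piecewise_C1_differentiable_on\<close>) the speed could be non-integrable, and its integral would
  then be 0 by convention.
\<close>

definition smooth_on_interval ::
  "(real \<Rightarrow> 'a::real_normed_vector) \<Rightarrow> real \<Rightarrow> real \<Rightarrow> bool" where
  "smooth_on_interval g u v \<longleftrightarrow>
     (\<exists>D :: nat \<Rightarrow> real \<Rightarrow> 'a.
        (\<forall>t\<in>{u..v}. D 0 t = g t) \<and>
        (\<forall>n. \<forall>t\<in>{u..v}. (D n has_vector_derivative D (Suc n) t) (at t within {u..v})))"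

definition piecewise_smooth :: "(real \<Rightarrow> 'a::real_normed_vector) \<Rightarrow> bool" where
  "piecewise_smooth g \<longleftrightarrow>
     (\<exists>(N::nat) \<tau>. \<tau> 0 = 0 \<and> \<tau> N = 1 \<and>
        (\<forall>i<N. \<tau> i < \<tau> (Suc i) \<and> smooth_on_interval g (\<tau> i) (\<tau> (Suc i))))"

abbreviation velocity :: "(real \<Rightarrow> 'a::real_normed_vector) \<Rightarrow> real \<Rightarrow> 'a" where
  "velocity g t \<equiv> vector_derivative g (at t within {0..1})"


section \<open>The Grassmann manifold\<close>

definition grassmannian :: "('h::complex_hilbert_space \<Rightarrow>\<^sub>L 'h) set" where
  "grassmannian = {P. orthogonal_projection P}"

definition grassmann_length :: "(real \<Rightarrow> 'h::complex_hilbert_space \<Rightarrow>\<^sub>L 'h) \<Rightarrow> real" where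
  "grassmann_length g = integral {0..1} (\<lambda>t. norm (velocity g t))"

definition grassmann_curves ::
  "'h::complex_hilbert_space set \<Rightarrow> 'h set \<Rightarrow> (real \<Rightarrow> 'h \<Rightarrow>\<^sub>L 'h) set" where
  "grassmann_curves S T =
     {g. piecewise_smooth g \<and> (\<forall>t\<in>{0..1}. g t \<in> grassmannian) \<and>
         g 0 = projection_onto S \<and> g 1 = projection_onto T}"

definition grassmann_dist ::
  "'h::complex_hilbert_space set \<Rightarrow> 'h set \<Rightarrow> real" where
  "grassmann_dist S T = (INF g\<in>grassmann_curves S T. grassmann_length g)"

definition Gamma_dist ::
  "('h::complex_hilbert_space \<Rightarrow> 'x \<Rightarrow> complex) \<Rightarrow> 'x \<Rightarrow> 'x \<Rightarrow> real" where
  "Gamma_dist ev a b = grassmann_dist (zero_space ev a) (zero_space ev b)"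


section \<open>The projective space\<close>

definition phase_rel :: "('h::complex_hilbert_space \<times> 'h) set" where
  "phase_rel = {(f, g). f \<in> sphere 0 1 \<and> g \<in> sphere 0 1 \<and> (\<exists>c. cmod c = 1 \<and> f = c *\<^sub>C g)}"

definition proj_class :: "'h::complex_hilbert_space \<Rightarrow> 'h set" where
  "proj_class f = phase_rel `` {f}"

definition projective_space :: "'h::complex_hilbert_space set set" where
  "projective_space = sphere 0 1 // phase_rel"

definition is_lift ::
  "(real \<Rightarrow> 'h::complex_hilbert_space) \<Rightarrow> (real \<Rightarrow> 'h set) \<Rightarrow> bool" where
  "is_lift \<sigma> \<gamma> \<longleftrightarrow>
     piecewise_smooth \<sigma> \<and> (\<forall>t\<in>{0..1}. \<sigma> t \<in> sphere 0 1 \<and> proj_class (\<sigma> t) = \<gamma> t)"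

text \<open>
  The sphere is a smooth circle bundle over the projective space, so the piecewise smooth curves
  in the projective space are exactly those that have a piecewise smooth lift to the sphere.
\<close>

definition piecewise_smooth_proj :: "(real \<Rightarrow> 'h::complex_hilbert_space set) \<Rightarrow> bool" where
  "piecewise_smooth_proj \<gamma> \<longleftrightarrow>
     (\<forall>t\<in>{0..1}. \<gamma> t \<in> projective_space) \<and> (\<exists>\<sigma>. is_lift \<sigma> \<gamma>)"

definition lift_length :: "(real \<Rightarrow> 'h::complex_hilbert_space) \<Rightarrow> real" where
  "lift_length \<sigma> =
     integral {0..1} (\<lambda>t. sqrt ((norm (velocity \<sigma> t))\<^sup>2 - (cmod (cinner (velocity \<sigma> t) (\<sigma> t)))\<^sup>2))"

text \<open>
  Any lift may be chosen: two lifts differ by a piecewise smooth phase factor, which changes the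
  velocity only by that factor and by a multiple of the lift, and so leaves the integrand unchanged.
\<close>

definition proj_length :: "(real \<Rightarrow> 'h::complex_hilbert_space set) \<Rightarrow> real" where
  "proj_length \<gamma> = lift_length (SOME \<sigma>. is_lift \<sigma> \<gamma>)"

definition proj_curves ::
  "'h::complex_hilbert_space set \<Rightarrow> 'h set \<Rightarrow> (real \<Rightarrow> 'h set) set" where
  "proj_curves p q = {\<gamma>. piecewise_smooth_proj \<gamma> \<and> \<gamma> 0 = p \<and> \<gamma> 1 = q}"

definition delta_check :: "('x \<Rightarrow> 'h::complex_hilbert_space) \<Rightarrow> 'x \<Rightarrow> 'x \<Rightarrow> real" where
  "delta_check k a b =
     (INF \<gamma>\<in>proj_curves (proj_class (k a /\<^sub>R norm (k a))) (proj_class (k b /\<^sub>R norm (k b))).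
        proj_length \<gamma>)"

end

theory Submission
  imports Defs
begin

text \<open>
  Normalize \<open>k a\<close> to \<open>e\<close> and write the normalized \<open>k b\<close>, up to a phase, as
  \<open>cos \<theta> e + sin \<theta> u\<close> with \<open>u\<close> a unit vector orthogonal to \<open>e\<close>. Along a curve of projections
  \<open>P\<close> the function \<open>y = 2 \<langle>P e, e\<rangle> - 1\<close>, and along a curve \<open>\<sigma>\<close> in the sphere that starts at a
  multiple of \<open>e\<close> the function \<open>y = 2 |\<langle>\<sigma>, \<sigma> 0\<rangle>|\<^sup>2 - 1\<close>, satisfies
  \<open>|y'| \<le> 2 w sqrt (1 - y\<^sup>2)\<close>, where \<open>w\<close> is the speed whose integral is the length. So \<open>arccos y\<close>
  varies by at most twice the length, and both distances are at least \<open>\<theta>\<close>; rotating \<open>e\<close> towards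
  the second vector in the plane of \<open>e\<close> and \<open>u\<close> attains \<open>\<theta>\<close>. The difference of the two
  projections is \<open>sin \<theta>\<close> times a reflection of that plane, so its nonzero singular value is
  \<open>sin \<theta>\<close>, with multiplicity two.
\<close>

section \<open>Complex inner product spaces and orthogonal projections\<close>

lemma cinner_zero_left [simp]: "cinner 0 y = 0"
  using cinner_add_left[of 0 0 y] by simp

lemma cinner_minus_left: "cinner (- x) y = - cinner x y"
  using cinner_add_left[of x "- x" y] by (simp add: eq_neg_iff_add_eq_0 add.commute)

lemma cinner_diff_left: "cinner (x - y) z = cinner x z - cinner y z"
  using cinner_add_left[of x "- y" z] by (simp add: cinner_minus_left)

lemma cinner_add_right: "cinner x (y + z) = cinner x y + cinner x z"
  by (metis cinner_add_left cinner_commute complex_cnj_add)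

lemma cinner_zero_right [simp]: "cinner x 0 = 0"
  using cinner_add_right[of x 0 0] by simp

lemma cinner_diff_right: "cinner x (y - z) = cinner x y - cinner x z"
  by (metis cinner_diff_left cinner_commute complex_cnj_diff)

lemma cinner_scaleC_right: "cinner x (c *\<^sub>C y) = cnj c * cinner x y"
  by (metis cinner_scaleC_left cinner_commute complex_cnj_mult)

lemma cinner_scaleR_left: "cinner (r *\<^sub>R x) y = of_real r * cinner x y"
  by (simp add: scaleR_eq_scaleC cinner_scaleC_left)

lemma cinner_scaleR_right: "cinner x (r *\<^sub>R y) = of_real r * cinner x y"
  by (simp add: scaleR_eq_scaleC cinner_scaleC_right)

lemmas cinner_linear = cinner_add_left cinner_add_right cinner_diff_left cinner_diff_right
  cinner_scaleC_left cinner_scaleC_right cinner_scaleR_left cinner_scaleR_right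

lemma cinner_self: "cinner x x = of_real ((norm x)\<^sup>2)"
proof -
  have "Im (cinner x x) = 0"
    using cinner_commute[of x x] by (metis Reals_cnj_iff complex_is_Real_iff)
  then show ?thesis
    by (simp add: complex_eq_iff power2_norm_eq_inner inner_eq_Re_cinner)
qed

lemma cmod_cinner_commute: "cmod (cinner x y) = cmod (cinner y x)"
  by (metis cinner_commute complex_mod_cnj)

lemma norm_scaleC: "norm (c *\<^sub>C x) = cmod c * norm x"
proof -
  have "of_real ((norm (c *\<^sub>C x))\<^sup>2) = c * cnj c * cinner x x"
    unfolding cinner_self[symmetric] cinner_linear by simp
  also have "\<dots> = of_real ((cmod c * norm x)\<^sup>2)"
    by (simp add: cinner_self complex_norm_square[symmetric] power_mult_distrib)
  finally have "(norm (c *\<^sub>C x))\<^sup>2 = (cmod c * norm x)\<^sup>2"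
    using of_real_eq_iff by blast
  then show ?thesis by simp
qed

lemma norm_add_orthogonal:
  assumes "cinner x y = 0"
  shows "(norm (x + y))\<^sup>2 = (norm x)\<^sup>2 + (norm y)\<^sup>2"
  using assms by (simp add: power2_norm_eq_inner inner_add inner_eq_Re_cinner[of x y]
    inner_commute[of y x])

text \<open>The real inner product sees only the real part, so a phase \<open>c\<close> first turns
  the complex product into its modulus; then the real inequality applies.\<close>

lemma cinner_Cauchy_Schwarz: "cmod (cinner x y) \<le> norm x * norm y"
proof (cases "cinner x y = 0")
  case False
  define c where "c = cnj (cinner x y) / of_real (cmod (cinner x y))"
  have "cmod c = 1" using False by (simp add: c_def norm_divide)
  have "cinner x y * cnj (cinner x y) = of_real (cmod (cinner x y)) * of_real (cmod (cinner x y))"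
    by (simp add: complex_norm_square[symmetric] power2_eq_square)
  then have "cinner (c *\<^sub>C x) y = of_real (cmod (cinner x y))"
    using False by (simp add: cinner_linear c_def field_simps)
  then have "cmod (cinner x y) = inner (c *\<^sub>C x) y" by (simp add: inner_eq_Re_cinner)
  also have "\<dots> \<le> norm (c *\<^sub>C x) * norm y" by (rule norm_cauchy_schwarz)
  finally show ?thesis by (simp add: norm_scaleC \<open>cmod c = 1\<close>)
qed simp

lemma bounded_bilinear_cinner: "bounded_bilinear cinner"
proof
  show "\<exists>K. \<forall>(a::'a) b. norm (cinner a b) \<le> norm a * norm b * K"
    by (intro exI[of _ 1]) (simp add: cinner_Cauchy_Schwarz)
qed (auto simp: cinner_linear scaleR_conv_of_real)

lemma bounded_bilinear_scaleC: "bounded_bilinear scaleC"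
proof
  show "\<exists>K. \<forall>a (b::'a). norm (a *\<^sub>C b) \<le> norm a * norm b * K"
    by (intro exI[of _ 1]) (simp add: norm_scaleC)
qed (auto simp: scaleC_add_left scaleC_add_right scaleR_eq_scaleC scaleC_scaleC 
  scaleR_conv_of_real mult.commute)

text \<open>The rank-one operator sending \<open>y\<close> to \<open>x\<close> when \<open>y\<close>
  is a unit vector; for a unit vector \<open>e\<close>, \<open>dyad e e\<close> is the orthogonal
  projection onto the complex line of \<open>e\<close>.\<close>

definition dyad :: "'h::complex_hilbert_space \<Rightarrow> 'h \<Rightarrow> ('h \<Rightarrow>\<^sub>L 'h)" where
  "dyad x y = Blinfun (\<lambda>z. cinner z y *\<^sub>C x)"

lemma dyad_apply [simp]: "dyad x y z = cinner z y *\<^sub>C x"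
proof -
  have "bounded_linear (\<lambda>z. cinner z y *\<^sub>C x)"
    by (rule bounded_linear_compose[OF bounded_bilinear.bounded_linear_left[OF bounded_bilinear_scaleC]
      bounded_bilinear.bounded_linear_left[OF bounded_bilinear_cinner]])
  then show ?thesis unfolding dyad_def by (simp add: bounded_linear_Blinfun_apply)
qed

text \<open>Each projection fixes the common range, so QP = P and PQ = Q; self-adjointness turns the
  first identity into PQ = P. This settles the uniqueness that \<open>projection_onto\<close>
  requires.\<close>

lemma orthogonal_projection_unique:
  assumes P: "orthogonal_projection P" and Q: "orthogonal_projection Q"
    and "range (blinfun_apply P) = range (blinfun_apply Q)"
  shows "P = Q"
proof (rule blinfun_eqI)
  fix y
  have fix_Q: "Q (Q x) = Q x" for x
    using Q unfolding orthogonal_projection_def by (metis blinfun_apply_blinfun_compose)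
  have "Q (P x) = P x" for x
    using assms(3) fix_Q by (metis (no_types, lifting) rangeE rangeI)
  \<comment> \<open>Move P to the left, insert Q in front of it, then move Q and P back to the
    right.\<close>
  then have "cinner x (P y) = cinner x (P (Q y))" for x
    using P Q unfolding orthogonal_projection_def by (metis (no_types))
  then have "cinner x (P y - P (Q y)) = 0" for x
    by (simp add: cinner_linear)
  then have "P y = P (Q y)"
    by (metis cinner_self eq_iff_diff_eq_0 norm_eq_zero of_real_eq_0_iff power_eq_0_iff)
  also have "P (Q y) = Q y"
    using assms(3) P unfolding orthogonal_projection_def
    by (metis (no_types, lifting) blinfun_apply_blinfun_compose rangeE rangeI)
  finally show "P y = Q y" .
qed

lemma orthogonal_projection_hyperplane:
  assumes "norm e = 1"
  shows "orthogonal_projection (id_blinfun - dyad e e)"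
    and "range (blinfun_apply (id_blinfun - dyad e e)) = {f. cinner f e = 0}"
proof -
  have ee: "cinner e e = 1" using assms by (simp add: cinner_self)
  have ec: "cnj (cinner y e) = cinner e y" for y using cinner_commute[of e y] by simp
  show "orthogonal_projection (id_blinfun - dyad e e)"
    unfolding orthogonal_projection_def complex_linear_def
    by (auto intro!: blinfun_eqI simp: blinfun.diff_left cinner_linear ee
        complex_vector.scale_right_diff_distrib scaleC_scaleC ec)
  show "range (blinfun_apply (id_blinfun - dyad e e)) = {f. cinner f e = 0}"
  proof safe
    fix f assume "cinner f e = 0"
    then have "f = (id_blinfun - dyad e e) f" by (simp add: blinfun.diff_left)
    then show "f \<in> range (blinfun_apply (id_blinfun - dyad e e))" by (rule range_eqI)
  qed (simp add: blinfun.diff_left cinner_linear ee)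
qed

lemma projection_onto_hyperplane:
  assumes "norm e = 1"
  shows "projection_onto {f. cinner f e = 0} = id_blinfun - dyad e e"
  unfolding projection_onto_def
  using orthogonal_projection_hyperplane[OF assms]
  by (intro the_equality conjI orthogonal_projection_unique) auto

section \<open>Relative position of two unit vectors\<close>

lemma unit_cinner_le_1:
  assumes "norm x = 1" "norm y = 1"
  shows "cmod (cinner x y) \<le> 1"
  using cinner_Cauchy_Schwarz[of x y] assms by simp

text \<open>Infinite dimension gives a vector off the line of \<open>e\<close>; one Gram-Schmidt
  step makes it orthogonal to \<open>e\<close>.\<close>

lemma exists_orthogonal_unit:
  fixes e :: "'h::complex_hilbert_space"
  assumes "\<not> (\<exists>B :: 'h set. finite B \<and> cspan B = UNIV)" "norm e = 1"
  shows "\<exists>u. norm u = 1 \<and> cinner e u = 0"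
proof -
  have "cspan {e} \<noteq> UNIV" using assms(1) by blast
  then obtain x where x: "x \<notin> cspan {e}" by blast
  define v where "v = x - cinner x e *\<^sub>C e"
  have "cinner x e *\<^sub>C e \<in> cspan {e}"
    by (intro complex_vector.span_scale complex_vector.span_base) simp
  then have "v \<noteq> 0" using x v_def by auto
  have "cinner v e = 0" using assms(2) by (simp add: v_def cinner_linear cinner_self)
  then have "cinner e (v /\<^sub>R norm v) = 0"
    using cinner_commute[of e v] by (simp add: cinner_linear)
  then show ?thesis using \<open>v \<noteq> 0\<close> by (intro exI[of _ "v /\<^sub>R norm v"]) simp
qed

text \<open>A phase makes the component of \<open>f\<close> along \<open>e\<close> real and
  nonnegative; the remainder is orthogonal to \<open>e\<close>, and Pythagoras gives its length. Two
  arbitrary unit vectors thus become two points of one great circle, up to a phase.\<close>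

lemma polar_decomposition:
  fixes e f :: "'h::complex_hilbert_space"
  assumes dim: "\<not> (\<exists>B :: 'h set. finite B \<and> cspan B = UNIV)"
    and e: "norm e = 1" and f: "norm f = 1"
  obtains u z where "norm u = 1" "cinner e u = 0" "cmod z = 1"
    "f = z *\<^sub>C (cmod (cinner e f) *\<^sub>R e + sqrt (1 - (cmod (cinner e f))\<^sup>2) *\<^sub>R u)"
proof -
  define c where "c = cmod (cinner e f)"
  have c: "0 \<le> c" "c \<le> 1" using unit_cinner_le_1[OF e f] by (auto simp: c_def)
  \<comment> \<open>For c = 0 the quotient would be 0, which is not a phase; any phase works then,
    and 1 is taken.\<close>
  define z where "z = (if c = 0 then 1 else cinner f e / of_real c)"
  have cz: "of_real c * z = cinner f e"
    using c_def cmod_cinner_commute[of e f] by (auto simp: z_def)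
  have z: "cmod z = 1"
    using c c_def cmod_cinner_commute[of e f] by (auto simp: z_def norm_divide)
  then have zz: "z * cnj z = 1" "cnj z * z = 1"
    by (simp_all add: complex_norm_square[symmetric] mult.commute[of "cnj z"])
  define v where "v = cnj z *\<^sub>C f - c *\<^sub>R e"
  have fv: "f = z *\<^sub>C (c *\<^sub>R e + v)"
    by (simp add: v_def scaleC_scaleC zz)
  have "cinner v e = cnj z * (of_real c * z) - of_real c"
    using e by (simp add: v_def cinner_linear cinner_self cz)
  also have "\<dots> = of_real c * (cnj z * z) - of_real c" by (simp only: ac_simps)
  also have "\<dots> = 0" by (simp add: zz)
  finally have ve: "cinner v e = 0" .
  then have ev: "cinner e v = 0" using cinner_commute[of e v] by simp
  have "1 = (norm (c *\<^sub>R e + v))\<^sup>2"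
    using f z arg_cong[OF fv, of norm] by (simp add: norm_scaleC)
  also have "\<dots> = c\<^sup>2 + (norm v)\<^sup>2"
    using norm_add_orthogonal[of "c *\<^sub>R e" v] ev e c by (simp add: cinner_linear)
  finally have nv: "sqrt (1 - c\<^sup>2) = norm v" by (simp add: real_sqrt_unique)
  show thesis
  proof (cases "v = 0")
    case True
    \<comment> \<open>The coefficient of \<open>u\<close> is 0 here, so any unit vector orthogonal
      to \<open>e\<close> serves.\<close>
    obtain u where "norm u = 1" "cinner e u = 0" using exists_orthogonal_unit[OF dim e] by auto
    then show ?thesis
      using that[of u z, folded c_def] z True nv fv[symmetric] by simp
  next
    case False
    then show ?thesis
      using that[of "v /\<^sub>R norm v" z, folded c_def] ev nv z
      by (simp add: cinner_linear fv[symmetric])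
  qed
qed

section \<open>Piecewise smooth curves and variation of angles\<close>

text \<open>Induction over the break points, gluing one piece at a time to the initial interval. It
  reduces statements about curves to their smooth pieces.\<close>

lemma piecewise_smooth_chain:
  assumes g: "piecewise_smooth g"
    and piece: "\<And>u v. \<lbrakk>0 \<le> u; u < v; v \<le> 1; smooth_on_interval g u v\<rbrakk> \<Longrightarrow> Q u v"
    and trans: "\<And>u v w. \<lbrakk>u < v; v < w; Q u v; Q v w\<rbrakk> \<Longrightarrow> Q u w"
  shows "Q 0 (1::real)"
proof -
  obtain N :: nat and \<tau> where \<tau>: "\<tau> 0 = 0" "\<tau> N = 1"
    and step: "\<And>i. i < N \<Longrightarrow> \<tau> i < \<tau> (Suc i)"
    and smooth: "\<And>i. i < N \<Longrightarrow> smooth_on_interval g (\<tau> i) (\<tau> (Suc i))"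
    using g unfolding piecewise_smooth_def by blast
  have le: "\<tau> i \<le> \<tau> j" if "i \<le> j" "j \<le> N" for i j
    using that by (induction rule: dec_induct) (use step in \<open>fastforce dest: Suc_le_lessD\<close>)+
  have Q_step: "Q (\<tau> i) (\<tau> (Suc i))" if "i < N" for i
    using piece smooth step that le[of 0 i] le[of "Suc i" N] \<tau> by auto
  \<comment> \<open>The induction starts with the whole first piece because \<open>Q\<close> is not
    assumed on degenerate intervals.\<close>
  have Q_init: "Q 0 (\<tau> (Suc i))" if "i < N" for i
    using that
  proof (induction i)
    case 0
    then show ?case using Q_step[of 0] \<tau> by simp
  next
    case (Suc i)
    have "0 < \<tau> (Suc i)" using step[of 0] le[of "Suc 0" "Suc i"] Suc.prems \<tau> by auto
    with Suc show ?case using trans[of 0 "\<tau> (Suc i)"] Q_step[of "Suc i"] step[of "Suc i"] by auto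
  qed
  have "N \<noteq> 0" using \<tau> by (metis zero_neq_one)
  then show ?thesis using Q_init[of "N - 1"] \<tau> by simp
qed

text \<open>The first derivative \<open>D 1\<close> of the smoothness witness is continuous up to
  the end points of the piece, while \<open>velocity\<close> is taken within the whole unit interval
  and agrees with it in the interior.\<close>

lemma smooth_on_interval_velocity:
  fixes g :: "real \<Rightarrow> 'a::real_normed_vector"
  assumes "smooth_on_interval g u v" and uv: "0 \<le> u" "u < v" "v \<le> 1"
  obtains d where "continuous_on {u..v} d"
    and "\<And>t. t \<in> {u..v} \<Longrightarrow> (g has_vector_derivative d t) (at t within {u..v})"
    and "\<And>t. t \<in> {u<..<v} \<Longrightarrow> (g has_vector_derivative d t) (at t)"
    and "\<And>t. t \<in> {u<..<v} \<Longrightarrow> velocity g t = d t"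
proof -
  obtain D :: "nat \<Rightarrow> real \<Rightarrow> 'a" where D0: "\<And>t. t \<in> {u..v} \<Longrightarrow> D 0 t = g t"
    and D: "\<And>n t. t \<in> {u..v} \<Longrightarrow> (D n has_vector_derivative D (Suc n) t) (at t within {u..v})"
    using assms(1) unfolding smooth_on_interval_def by blast
  have g: "(g has_vector_derivative D 1 t) (at t within {u..v})" if "t \<in> {u..v}" for t
    using has_vector_derivative_transform[OF that, of g "D 0"] D0 D[OF that, of 0] by simp
  have g_at: "(g has_vector_derivative D 1 t) (at t)" if "t \<in> {u<..<v}" for t
    using g[of t] that at_within_interior[of t "{u..v}"] by (simp add: interior_atLeastAtMost_real)
  show thesis
  proof
    show "continuous_on {u..v} (D 1)"
      by (auto simp: continuous_on_eq_continuous_within intro: has_vector_derivative_continuous[OF D])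
    show "velocity g t = D 1 t" if "t \<in> {u<..<v}" for t
    proof -
      have "at t within {0..1} = at t"
        using that uv by (intro at_within_interior) (simp add: interior_atLeastAtMost_real)
      then show ?thesis using vector_derivative_at[OF g_at[OF that]] by simp
    qed
  qed (use g g_at in auto)
qed

text \<open>Each piece contributes its two end points to the exceptional set.\<close>

lemma piecewise_smooth_velocity:
  assumes "piecewise_smooth g"
  obtains S where "finite S"
    "\<And>t. t \<in> {0..1} - S \<Longrightarrow> (g has_vector_derivative velocity g t) (at t)"
proof -
  have "\<exists>S. finite S \<and> (\<forall>t \<in> {0..1} - S. (g has_vector_derivative velocity g t) (at t))"
    using assms
  proof (rule piecewise_smooth_chain[where Q = "\<lambda>u v. \<exists>S. finite S \<and>
      (\<forall>t \<in> {u..v} - S. (g has_vector_derivative velocity g t) (at t))"])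
    fix u v :: real
    assume "0 \<le> u" "u < v" "v \<le> 1" "smooth_on_interval g u v"
    then obtain d where "\<And>t. t \<in> {u<..<v} \<Longrightarrow> (g has_vector_derivative d t) (at t)"
      "\<And>t. t \<in> {u<..<v} \<Longrightarrow> velocity g t = d t"
      using smooth_on_interval_velocity by metis
    then show "\<exists>S. finite S \<and> (\<forall>t \<in> {u..v} - S. (g has_vector_derivative velocity g t) (at t))"
      by (intro exI[of _ "{u, v}"]) auto
  next
    fix u v w :: real
    assume "\<exists>S. finite S \<and> (\<forall>t \<in> {u..v} - S. (g has_vector_derivative velocity g t) (at t))"
      "\<exists>S. finite S \<and> (\<forall>t \<in> {v..w} - S. (g has_vector_derivative velocity g t) (at t))"
    then obtain S T where "finite S" "\<forall>t \<in> {u..v} - S. (g has_vector_derivative velocity g t) (at t)"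
      "finite T" "\<forall>t \<in> {v..w} - T. (g has_vector_derivative velocity g t) (at t)" by blast
    then show "\<exists>S. finite S \<and> (\<forall>t \<in> {u..w} - S. (g has_vector_derivative velocity g t) (at t))"
      by (intro exI[of _ "S \<union> T"]) (use linear[of v] in fastforce)
  qed
  then show thesis using that by blast
qed

text \<open>Where |y| < 1, the derivative of arccos y is - y' / sqrt (1 - y^2), which
  \<open>bound\<close> limits to 2 w in modulus; integration gives the claim.\<close>

lemma arccos_variation_le:
  fixes y y' w :: "real \<Rightarrow> real"
  assumes uv: "u \<le> v"
    and deriv: "\<And>t. t \<in> {u..v} \<Longrightarrow> (y has_real_derivative y' t) (at t within {u..v})"
    and range: "\<And>t. t \<in> {u..v} \<Longrightarrow> \<bar>y t\<bar> \<le> 1"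
    and bound: "\<And>t. t \<in> {u..v} \<Longrightarrow> \<bar>y' t\<bar> \<le> 2 * w t * sqrt (1 - (y t)\<^sup>2)"
    and w_nonneg: "\<And>t. t \<in> {u..v} \<Longrightarrow> 0 \<le> w t"
    and w: "w integrable_on {u..v}"
  shows "\<bar>arccos (y v) - arccos (y u)\<bar> \<le> 2 * integral {u..v} w"
proof -
  \<comment> \<open>\<open>arccos\<close> is not differentiable at \<open>\<plusminus>1\<close>, so shrink \<open>y\<close> by a factor \<open>r < 1\<close>
    and let \<open>r\<close> tend to 1.\<close>
  have scaled: "\<bar>arccos (r * y v) - arccos (r * y u)\<bar> \<le> 2 * integral {u..v} w"
    if r: "0 \<le> r" "r < 1" for r
  proof -
    have small: "\<bar>r * y t\<bar> < 1" if "t \<in> {u..v}" for t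
      using mult_left_mono[OF range[OF that] r(1)] r by (simp add: abs_mult)
    define F where "F t = - (inverse (sqrt (1 - (r * y t)\<^sup>2)) * (r * y' t))" for t
    have F: "(F has_integral arccos (r * y v) - arccos (r * y u)) {u..v}"
    proof (rule fundamental_theorem_of_calculus[OF uv])
      fix t assume t: "t \<in> {u..v}"
      have "((\<lambda>t. arccos (r * y t)) has_real_derivative F t) (at t within {u..v})"
        using small[OF t] unfolding F_def
        by (auto intro!: derivative_eq_intros deriv[OF t] simp: abs_less_iff)
      then show "((\<lambda>t. arccos (r * y t)) has_vector_derivative F t) (at t within {u..v})"
        by (simp add: has_real_derivative_iff_has_vector_derivative)
    qed
    have bound_F: "norm (F t) \<le> 2 * w t" if t: "t \<in> {u..v}" for t
    proof -
      have pos: "0 < sqrt (1 - (r * y t)\<^sup>2)"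
        using small[OF t] by (simp add: abs_square_less_1)
      have "r\<^sup>2 \<le> 1" using r by (simp add: abs_square_le_1)
      \<comment> \<open>The square of the left side is r^2 - (r y)^2, and r^2 is at most 1.\<close>
      then have "r * sqrt (1 - (y t)\<^sup>2) \<le> sqrt (1 - (r * y t)\<^sup>2)"
        using r by (intro real_le_rsqrt)
          (simp add: power_mult_distrib algebra_simps abs_square_le_1 range[OF t])
      then have "2 * w t * (r * sqrt (1 - (y t)\<^sup>2)) \<le> 2 * w t * sqrt (1 - (r * y t)\<^sup>2)"
        using w_nonneg[OF t] by (intro mult_left_mono) auto
      moreover have "r * \<bar>y' t\<bar> \<le> r * (2 * w t * sqrt (1 - (y t)\<^sup>2))"
        using bound[OF t] r by (intro mult_left_mono) auto
      ultimately have "r * \<bar>y' t\<bar> \<le> 2 * w t * sqrt (1 - (r * y t)\<^sup>2)" by (simp add: ac_simps)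
      then show ?thesis
        using pos r by (simp add: F_def abs_mult field_simps)
    qed
    have "norm (integral {u..v} F) \<le> integral {u..v} (\<lambda>t. 2 * w t)"
      using F w bound_F by (intro integral_norm_bound_integral) auto
    then show ?thesis
      using integral_unique[OF F] by simp
  qed
  \<comment> \<open>The factors r = n / (n + 1) tend to 1 from below, and \<open>arccos\<close> is
    continuous on the closed interval from -1 to 1.\<close>
  have lim: "(\<lambda>n. arccos (of_nat n / of_nat (Suc n) * y t)) \<longlonglongrightarrow> arccos (y t)"
    if "t \<in> {u..v}" for t
  proof (rule continuous_on_tendsto_compose[OF continuous_on_arccos'])
    show "(\<lambda>n. of_nat n / of_nat (Suc n) * y t) \<longlonglongrightarrow> y t"
      using tendsto_mult[OF LIMSEQ_n_over_Suc_n tendsto_const[of "y t"]] by simp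
    have "\<bar>real n / real (Suc n) * y t\<bar> \<le> 1" for n
      using mult_mono[of "of_nat n / of_nat (Suc n)" 1 "\<bar>y t\<bar>" 1] range[OF that]
      by (simp add: abs_mult)
    then show "\<forall>\<^sub>F n in sequentially. of_nat n / of_nat (Suc n) * y t \<in> {-1..1}"
      by (intro always_eventually allI) (metis abs_le_D1 abs_le_D2 atLeastAtMost_iff minus_le_iff)
  qed (use range[OF that] in auto)
  have "\<bar>arccos (real n / real (Suc n) * y v) - arccos (real n / real (Suc n) * y u)\<bar>
      \<le> 2 * integral {u..v} w" for n
    by (rule scaled) auto
  then show ?thesis
    using LIMSEQ_le_const2[OF tendsto_rabs[OF tendsto_diff[OF lim lim]]] uv by auto
qed

text \<open>Integrals add over adjacent pieces, and the variation obeys the triangle inequality.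
  Integrability is carried through the induction because additivity needs it on the joined
  interval.\<close>

lemma piecewise_arccos_variation_le:
  assumes "piecewise_smooth g"
    and piece: "\<And>u v. \<lbrakk>0 \<le> u; u < v; v \<le> 1; smooth_on_interval g u v\<rbrakk> \<Longrightarrow>
      w integrable_on {u..v} \<and> \<bar>arccos (y v) - arccos (y u)\<bar> \<le> 2 * integral {u..v} w"
  shows "\<bar>arccos (y 1) - arccos (y 0)\<bar> \<le> 2 * integral {0..1} (w :: real \<Rightarrow> real)"
proof -
  have "w integrable_on {0..1} \<and> \<bar>arccos (y 1) - arccos (y 0)\<bar> \<le> 2 * integral {0..1} w"
    using assms(1) piece
  proof (rule piecewise_smooth_chain[where Q = "\<lambda>u v. w integrable_on {u..v} \<and>
      \<bar>arccos (y v) - arccos (y u)\<bar> \<le> 2 * integral {u..v} w"])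
    fix r s t :: real
    assume rst: "r < s" "s < t"
      and 1: "w integrable_on {r..s} \<and> \<bar>arccos (y s) - arccos (y r)\<bar> \<le> 2 * integral {r..s} w"
      and 2: "w integrable_on {s..t} \<and> \<bar>arccos (y t) - arccos (y s)\<bar> \<le> 2 * integral {s..t} w"
    then have int: "w integrable_on {r..t}"
      using Henstock_Kurzweil_Integration.integrable_combine[where a = r and c = s and b = t and f = w] by auto
    then have "integral {r..t} w = integral {r..s} w + integral {s..t} w"
      using Henstock_Kurzweil_Integration.integral_combine[where a = r and c = s and b = t and f = w] rst by simp
    with int 1 2
    show "w integrable_on {r..t} \<and> \<bar>arccos (y t) - arccos (y r)\<bar> \<le> 2 * integral {r..t} w"
      by auto
  qed auto
  then show ?thesis by blast
qed

text \<open>\<open>w\<close> is built from the velocity, which at a break point may be a junk value; \<open>W\<close> is its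
  continuous extension from the interior of the piece.\<close>

lemma arccos_variation_le_piece:
  fixes y y' w W :: "real \<Rightarrow> real"
  assumes uv: "u < v"
    and deriv: "\<And>t. t \<in> {u..v} \<Longrightarrow> (y has_real_derivative y' t) (at t within {u..v})"
    and range: "\<And>t. t \<in> {u..v} \<Longrightarrow> \<bar>y t\<bar> \<le> 1"
    and bound: "\<And>t. t \<in> {u..v} \<Longrightarrow> \<bar>y' t\<bar> \<le> 2 * W t * sqrt (1 - (y t)\<^sup>2)"
    and W: "continuous_on {u..v} W" "\<And>t. t \<in> {u..v} \<Longrightarrow> 0 \<le> W t"
    and eq: "\<And>t. t \<in> {u<..<v} \<Longrightarrow> w t = W t"
  shows "w integrable_on {u..v} \<and> \<bar>arccos (y v) - arccos (y u)\<bar> \<le> 2 * integral {u..v} w"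
proof -
  have "W integrable_on {u..v}" using W(1) by (rule integrable_continuous_real)
  moreover have "w t = W t" if "t \<in> {u..v} - {u, v}" for t using eq that by auto
  ultimately have "w integrable_on {u..v}" "integral {u..v} w = integral {u..v} W"
    using integrable_spike[of W "{u..v}" "{u, v}" w] integral_spike[of "{u, v}" "{u..v}" w W] by auto
  then show ?thesis
    using arccos_variation_le[OF _ deriv range bound W(2)] \<open>W integrable_on {u..v}\<close> uv by auto
qed

text \<open>Since 2P - 1 is a symmetry, v = (2P - 1) e moves in the unit sphere with speed at most
  twice that of P. Its velocity is orthogonal to v, so it pairs only with the part of
  \<open>e\<close> orthogonal to v, whose norm is sqrt (1 - y^2) with y the inner product of v and
  \<open>e\<close>.\<close>

lemma grassmann_length_lower_bound:
  fixes g :: "real \<Rightarrow> 'h::complex_hilbert_space \<Rightarrow>\<^sub>L 'h"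
  assumes g: "piecewise_smooth g" and proj: "\<And>t. t \<in> {0..1} \<Longrightarrow> g t \<in> grassmannian"
    and e: "norm e = 1"
  shows "\<bar>arccos (inner (2 *\<^sub>R g 1 e - e) e) - arccos (inner (2 *\<^sub>R g 0 e - e) e)\<bar>
    \<le> 2 * grassmann_length g"
  unfolding grassmann_length_def
  using g
proof (rule piecewise_arccos_variation_le[where y = "\<lambda>t. inner (2 *\<^sub>R g t e - e) e"])
  fix a b :: real
  assume ab: "0 \<le> a" "a < b" "b \<le> 1" and smooth: "smooth_on_interval g a b"
  obtain d where d: "continuous_on {a..b} d"
    "\<And>t. t \<in> {a..b} \<Longrightarrow> (g has_vector_derivative d t) (at t within {a..b})"
    "\<And>t. t \<in> {a<..<b} \<Longrightarrow> velocity g t = d t"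
    using smooth_on_interval_velocity[OF smooth ab] by metis
  define v where "v t = 2 *\<^sub>R g t e - e" for t
  have v: "(v has_vector_derivative 2 *\<^sub>R d t e) (at t within {a..b})" if "t \<in> {a..b}" for t
    unfolding v_def
    by (auto intro!: derivative_eq_intros
      bounded_linear.has_vector_derivative[OF blinfun.bounded_linear_left] d(2)[OF that])
  have unit: "inner (v t) (v t) = 1" if "t \<in> {a..b}" for t
  proof -
    have P: "orthogonal_projection (g t)" using proj[of t] that ab by (simp add: grassmannian_def)
    \<comment> \<open>This identity makes the quadratic and the mixed terms cancel when the squared
      norm of 2Pe - e is expanded.\<close>
    have "inner (g t e) (g t e) = inner e (g t e)"
      using P unfolding orthogonal_projection_def inner_eq_Re_cinner
      by (metis blinfun_apply_blinfun_compose)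
    then show ?thesis
      using e by (simp add: v_def inner_diff inner_commute norm_eq_1)
  qed
  show "(\<lambda>t. norm (velocity g t)) integrable_on {a..b} \<and>
      \<bar>arccos (inner (2 *\<^sub>R g b e - e) e) - arccos (inner (2 *\<^sub>R g a e - e) e)\<bar>
        \<le> 2 * integral {a..b} (\<lambda>t. norm (velocity g t))"
    unfolding v_def[symmetric] using ab(2)
  proof (rule arccos_variation_le_piece[where W = "\<lambda>t. norm (d t)"])
    fix t assume t: "t \<in> {a..b}"
    show "((\<lambda>t. inner (v t) e) has_real_derivative inner (2 *\<^sub>R d t e) e) (at t within {a..b})"
      using bounded_linear.has_vector_derivative[OF bounded_linear_inner_left v[OF t]]
      by (simp add: has_real_derivative_iff_has_vector_derivative)
    have "norm (v t) = 1" using unit[OF t] by (simp add: norm_eq_1)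
    then show "\<bar>inner (v t) e\<bar> \<le> 1"
      using Cauchy_Schwarz_ineq2[of "v t" e] e by simp
    have "((\<lambda>t. inner (v t) (v t)) has_vector_derivative
        inner (v t) (2 *\<^sub>R d t e) + inner (2 *\<^sub>R d t e) (v t)) (at t within {a..b})"
      by (rule bounded_bilinear.has_vector_derivative[OF bounded_bilinear_inner v[OF t] v[OF t]])
    moreover have "((\<lambda>t. inner (v t) (v t)) has_vector_derivative 0) (at t within {a..b})"
      by (rule has_vector_derivative_transform[OF t _ has_vector_derivative_const[of 1]])
        (use unit in auto)
    ultimately have "inner (v t) (2 *\<^sub>R d t e) + inner (2 *\<^sub>R d t e) (v t) = 0"
      using vector_derivative_unique_within_closed_interval[of a b t] t ab by auto
    then have "inner (2 *\<^sub>R d t e) (v t) = 0"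
      by (simp only: inner_commute[of "v t"])
    then have "inner (2 *\<^sub>R d t e) e = inner (2 *\<^sub>R d t e) (e - inner (v t) e *\<^sub>R v t)"
      by (simp add: inner_diff)
    also have "\<bar>\<dots>\<bar> \<le> norm (2 *\<^sub>R d t e) * norm (e - inner (v t) e *\<^sub>R v t)"
      by (rule Cauchy_Schwarz_ineq2)
    also have "norm (e - inner (v t) e *\<^sub>R v t) = sqrt (1 - (inner (v t) e)\<^sup>2)"
      using unit[OF t] e
      by (simp add: norm_eq_sqrt_inner inner_diff inner_commute norm_eq_1 power2_eq_square)
    also have "norm (2 *\<^sub>R d t e) \<le> 2 * norm (d t)"
      using norm_blinfun[of "d t" e] e by simp
    finally show "\<bar>inner (2 *\<^sub>R d t e) e\<bar> \<le> 2 * norm (d t) * sqrt (1 - (inner (v t) e)\<^sup>2)"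
      using \<open>\<bar>inner (v t) e\<bar> \<le> 1\<close> by (simp add: mult_right_mono abs_square_le_1)
  qed (use d in \<open>auto intro: continuous_intros\<close>)
qed

section \<open>Lifts of curves in the projective space\<close>

text \<open>Pythagoras. With \<open>x\<close> the velocity of a lift at the point \<open>s\<close>,
  the right side is the integrand of \<open>lift_length\<close>, which is thus the norm of the
  horizontal part of the velocity.\<close>

lemma norm_orthogonal_part:
  assumes "norm s = 1"
  shows "norm (x - cinner x s *\<^sub>C s) = sqrt ((norm x)\<^sup>2 - (cmod (cinner x s))\<^sup>2)"
proof -
  have "cinner (x - cinner x s *\<^sub>C s) (cinner x s *\<^sub>C s) = 0"
    using assms by (simp add: cinner_linear cinner_self)
  from norm_add_orthogonal[OF this] show ?thesis
    using assms by (simp add: norm_scaleC real_sqrt_unique)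
qed

text \<open>The double angle formula; c >= 0 keeps 2 arccos c within the range of
  \<open>arccos\<close>.\<close>

lemma arccos_double: "0 \<le> c \<Longrightarrow> c \<le> 1 \<Longrightarrow> arccos (2 * c\<^sup>2 - 1) = 2 * arccos c"
  using arccos_cos[of "2 * arccos c"] arccos_lbound[of c] arccos_le_pi2[of c]
  by (simp add: cos_double_cos cos_arccos)

text \<open>The doubled angle is used because |z|^2 is differentiable even where z vanishes. The
  horizontal part h of the velocity alone changes |z|, and it pairs only with the part k of
  \<open>e\<close> orthogonal to the curve, so |y'| is at most 4 |z| |h| |k| = 2 |h| sqrt (1 -
  y^2).\<close>

lemma lift_length_lower_bound:
  fixes g :: "real \<Rightarrow> 'h::complex_hilbert_space"
  assumes g: "piecewise_smooth g" and sphere: "\<And>t. t \<in> {0..1} \<Longrightarrow> norm (g t) = 1"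
  shows "arccos (cmod (cinner (g 0) (g 1))) \<le> lift_length g"
proof -
  define e where "e = g 0"
  have e: "norm e = 1" using sphere[of 0] by (simp add: e_def)
  define z where "z t = cinner (g t) e" for t
  define y where "y t = 2 * (cmod (z t))\<^sup>2 - 1" for t
  have z_le: "cmod (z t) \<le> 1" if "t \<in> {0..1}" for t
    unfolding z_def by (rule unit_cinner_le_1[OF sphere[OF that] e])
  have "\<bar>arccos (y 1) - arccos (y 0)\<bar> \<le> 2 * lift_length g"
    unfolding lift_length_def
    using g
  proof (rule piecewise_arccos_variation_le[where y = y])
    fix a b :: real
    assume ab: "0 \<le> a" "a < b" "b \<le> 1" and smooth: "smooth_on_interval g a b"
    obtain d where d: "continuous_on {a..b} d"
      "\<And>t. t \<in> {a..b} \<Longrightarrow> (g has_vector_derivative d t) (at t within {a..b})"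
      "\<And>t. t \<in> {a<..<b} \<Longrightarrow> velocity g t = d t"
      using smooth_on_interval_velocity[OF smooth ab] by metis
    have sphere': "norm (g t) = 1" if "t \<in> {a..b}" for t using sphere[of t] that ab by auto
    show "(\<lambda>t. sqrt ((norm (velocity g t))\<^sup>2 - (cmod (cinner (velocity g t) (g t)))\<^sup>2)) integrable_on {a..b} \<and>
        \<bar>arccos (y b) - arccos (y a)\<bar> \<le> 2 * integral {a..b}
          (\<lambda>t. sqrt ((norm (velocity g t))\<^sup>2 - (cmod (cinner (velocity g t) (g t)))\<^sup>2))"
      using ab(2)
    proof (rule arccos_variation_le_piece
        [where W = "\<lambda>t. sqrt ((norm (d t))\<^sup>2 - (cmod (cinner (d t) (g t)))\<^sup>2)"])
      have "continuous_on {a..b} g"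
        by (auto simp: continuous_on_eq_continuous_within intro: has_vector_derivative_continuous[OF d(2)])
      then show "continuous_on {a..b} (\<lambda>t. sqrt ((norm (d t))\<^sup>2 - (cmod (cinner (d t) (g t)))\<^sup>2))"
        by (intro continuous_intros bounded_bilinear.continuous_on[OF bounded_bilinear_cinner] d(1))
      fix t assume t: "t \<in> {a..b}"
      have z: "(z has_vector_derivative cinner (d t) e) (at t within {a..b})"
        unfolding z_def
        by (rule bounded_linear.has_vector_derivative
          [OF bounded_bilinear.bounded_linear_left[OF bounded_bilinear_cinner] d(2)[OF t]])
      have "((\<lambda>t. inner (z t) (z t)) has_vector_derivative
          inner (z t) (cinner (d t) e) + inner (cinner (d t) e) (z t)) (at t within {a..b})"
        by (rule bounded_bilinear.has_vector_derivative[OF bounded_bilinear_inner z z])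
      then have "((\<lambda>t. (cmod (z t))\<^sup>2) has_real_derivative 2 * inner (z t) (cinner (d t) e)) (at t within {a..b})"
        by (simp add: has_real_derivative_iff_has_vector_derivative power2_norm_eq_inner
          inner_commute[of "cinner (d t) e"])
      from DERIV_diff[OF DERIV_cmult[OF this, of 2] DERIV_const[of 1]]
      show "(y has_real_derivative 4 * inner (z t) (cinner (d t) e)) (at t within {a..b})"
        unfolding y_def by simp
      have z1: "cmod (z t) \<le> 1" using z_le t ab by auto
      then have "(cmod (z t))\<^sup>2 \<le> 1" by (simp add: abs_square_le_1)
      then show "\<bar>y t\<bar> \<le> 1" by (simp add: y_def abs_le_iff)
      show "0 \<le> sqrt ((norm (d t))\<^sup>2 - (cmod (cinner (d t) (g t)))\<^sup>2)"
        using norm_orthogonal_part[OF sphere'[OF t], of "d t"] by (metis norm_ge_zero)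
      have "((\<lambda>t. inner (g t) (g t)) has_vector_derivative
          inner (g t) (d t) + inner (d t) (g t)) (at t within {a..b})"
        by (rule bounded_bilinear.has_vector_derivative[OF bounded_bilinear_inner d(2)[OF t] d(2)[OF t]])
      moreover have "((\<lambda>t. inner (g t) (g t)) has_vector_derivative 0) (at t within {a..b})"
        by (rule has_vector_derivative_transform[OF t _ has_vector_derivative_const[of 1]])
          (use sphere' in \<open>auto simp: norm_eq_1\<close>)
      ultimately have "inner (g t) (d t) + inner (d t) (g t) = 0"
        using vector_derivative_unique_within_closed_interval[of a b t] t ab by auto
      then have "inner (d t) (g t) = 0"
        by (simp only: inner_commute[of "g t"])
      then have Re0: "Re (cinner (d t) (g t)) = 0" by (simp only: inner_eq_Re_cinner)
      define h where "h = d t - cinner (d t) (g t) *\<^sub>C g t"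
      define k where "k = e - cinner e (g t) *\<^sub>C g t"
      have gg: "cinner (g t) (g t) = 1" using sphere'[OF t] by (simp add: cinner_self)
      have hg: "cinner h (g t) = 0" by (simp add: h_def cinner_linear gg)
      have he: "cinner h e = cinner h k" by (simp add: k_def cinner_linear hg)
      \<comment> \<open>The factor is purely imaginary, so the vertical part of the velocity only
        rotates z and leaves its modulus stationary.\<close>
      have "inner (z t) (cinner (d t) (g t) * z t) = 0"
        by (simp add: inner_complex_def Re0 algebra_simps)
      then have "inner (z t) (cinner (d t) e) = inner (z t) (cinner h e)"
        by (simp add: h_def z_def cinner_linear inner_diff)
      also have "\<bar>\<dots>\<bar> \<le> cmod (z t) * (norm h * norm k)"
        unfolding he
        by (rule order_trans[OF Cauchy_Schwarz_ineq2]) (intro mult_left_mono cinner_Cauchy_Schwarz norm_ge_zero)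
      finally have "\<bar>4 * inner (z t) (cinner (d t) e)\<bar> \<le> 2 * norm h * (2 * cmod (z t) * norm k)"
        by (simp add: abs_mult ac_simps)
      also have "norm h = sqrt ((norm (d t))\<^sup>2 - (cmod (cinner (d t) (g t)))\<^sup>2)"
        unfolding h_def by (rule norm_orthogonal_part[OF sphere'[OF t]])
      also have "norm k = sqrt (1 - (cmod (z t))\<^sup>2)"
        unfolding k_def using norm_orthogonal_part[OF sphere'[OF t], of e] e
        by (simp add: z_def cmod_cinner_commute[of e])
      also have "2 * cmod (z t) * \<dots> = sqrt ((2 * cmod (z t))\<^sup>2 * (1 - (cmod (z t))\<^sup>2))"
        by (simp only: real_sqrt_mult real_sqrt_abs) simp
      \<comment> \<open>With x = |z|^2 this reads 4 x (1 - x) = 1 - (2 x - 1)^2.\<close>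
      also have "(2 * cmod (z t))\<^sup>2 * (1 - (cmod (z t))\<^sup>2) = 1 - (y t)\<^sup>2"
        by (simp add: y_def algebra_simps power2_eq_square)
      finally show "\<bar>4 * inner (z t) (cinner (d t) e)\<bar>
        \<le> 2 * sqrt ((norm (d t))\<^sup>2 - (cmod (cinner (d t) (g t)))\<^sup>2) * sqrt (1 - (y t)\<^sup>2)" .
    qed (use d(3) in auto)
  qed
  moreover have "y 0 = 1" using e by (simp add: y_def z_def e_def cinner_self norm_power)
  moreover have "arccos (y 1) = 2 * arccos (cmod (cinner (g 0) (g 1)))"
    using z_le[of 1] arccos_double[of "cmod (z 1)"]
    by (simp add: y_def z_def e_def cmod_cinner_commute[of "g 0"])
  ultimately show ?thesis by simp
qed

section \<open>Phases and independence of the lift\<close>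

lemma proj_class_eqD:
  assumes "norm f = 1" "norm g = 1" "proj_class f = proj_class g"
  obtains c where "cmod c = 1" "f = c *\<^sub>C g"
proof -
  have "g \<in> proj_class g"
    using assms(2) by (auto simp: proj_class_def phase_rel_def intro!: exI[of _ 1])
  then have "(f, g) \<in> phase_rel" using assms(3) by (auto simp: proj_class_def)
  then show thesis using that by (auto simp: phase_rel_def)
qed

lemma proj_class_phase:
  assumes "norm f = 1" "cmod c = 1"
  shows "proj_class (c *\<^sub>C f) = proj_class f"
proof -
  have c: "c * cnj c = 1" using assms(2) by (simp add: complex_norm_square[symmetric])
  have "\<exists>d'. cmod d' = 1 \<and> c *\<^sub>C f = d' *\<^sub>C g" if "f = d *\<^sub>C g" "cmod d = 1" for d g
    using that assms(2) by (intro exI[of _ "c * d"]) (simp add: scaleC_scaleC norm_mult)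
  moreover have "\<exists>d'. cmod d' = 1 \<and> f = d' *\<^sub>C g" if "c *\<^sub>C f = d *\<^sub>C g" "cmod d = 1" for d g
  proof -
    have "f = (cnj c * d) *\<^sub>C g"
      using arg_cong[OF that(1), of "scaleC (cnj c)"] c by (simp add: scaleC_scaleC mult.commute)
    then show ?thesis
      using that assms(2) by (intro exI[of _ "cnj c * d"]) (simp add: norm_mult)
  qed
  ultimately show ?thesis
    using assms by (auto simp: proj_class_def phase_rel_def norm_scaleC) metis+
qed

text \<open>Two lifts differ by a phase c. Its derivative adds only a multiple of the lift to the
  velocity, so the horizontal part is just multiplied by c and keeps its norm.\<close>

lemma lift_length_unique:
  fixes f g :: "real \<Rightarrow> 'h::complex_hilbert_space"
  assumes f: "is_lift f \<gamma>" and g: "is_lift g \<gamma>"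
  shows "lift_length f = lift_length g"
proof -
  have unit: "norm (f t) = 1" "norm (g t) = 1" if "t \<in> {0..1}" for t
    using f g that by (auto simp: is_lift_def)
  \<comment> \<open>Writing the phase as an inner product makes it differentiable wherever both
    lifts are.\<close>
  define c where "c t = cinner (f t) (g t)" for t
  have c: "cmod (c t) = 1 \<and> f t = c t *\<^sub>C g t" if t: "t \<in> {0..1}" for t
  proof -
    have "proj_class (f t) = proj_class (g t)" using f g t by (auto simp: is_lift_def)
    then obtain z where z: "cmod z = 1" "f t = z *\<^sub>C g t"
      using proj_class_eqD unit[OF t] by blast
    then have "c t = z" using unit(2)[OF t] by (simp add: c_def cinner_linear cinner_self)
    then show ?thesis using z by simp
  qed
  obtain S where S: "finite S"
    "\<And>t. t \<in> {0..1} - S \<Longrightarrow> (f has_vector_derivative velocity f t) (at t)"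
    using piecewise_smooth_velocity[of f] f by (auto simp: is_lift_def)
  obtain T where T: "finite T"
    "\<And>t. t \<in> {0..1} - T \<Longrightarrow> (g has_vector_derivative velocity g t) (at t)"
    using piecewise_smooth_velocity[of g] g by (auto simp: is_lift_def)
  show ?thesis
    unfolding lift_length_def
  proof (rule integral_spike[of "S \<union> T \<union> {0, 1}"])
    \<comment> \<open>The end points are excluded too, since f = c g is known only on the unit
      interval and two-sided derivatives need an open neighbourhood.\<close>
    show "negligible (S \<union> T \<union> {0, 1})" using S T by (intro negligible_finite) auto
    fix t assume t: "t \<in> {0..1} - (S \<union> T \<union> {0, 1})"
    have t01: "t \<in> {0..1}" "t \<in> {0<..<1}" using t by auto
    define f' where "f' = velocity f t"
    define g' where "g' = velocity g t"
    define c' where "c' = cinner (f t) g' + cinner f' (g t)"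
    have df: "(f has_vector_derivative f') (at t)" using S t by (auto simp: f'_def)
    have dg: "(g has_vector_derivative g') (at t)" using T t by (auto simp: g'_def)
    have dc: "(c has_vector_derivative c') (at t)"
      unfolding c_def c'_def
      by (rule bounded_bilinear.has_vector_derivative[OF bounded_bilinear_cinner df dg])
    have "((\<lambda>t. c t *\<^sub>C g t) has_vector_derivative c t *\<^sub>C g' + c' *\<^sub>C g t) (at t)"
      by (rule bounded_bilinear.has_vector_derivative[OF bounded_bilinear_scaleC dc dg])
    then have "(f has_vector_derivative c t *\<^sub>C g' + c' *\<^sub>C g t) (at t)"
      by (rule has_vector_derivative_transform_within_open[of _ _ _ "{0<..<1}"])
        (use t01 c in auto)
    then have f': "f' = c t *\<^sub>C g' + c' *\<^sub>C g t"
      using df vector_derivative_unique_at by blast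
    have gg: "cinner (g t) (g t) = 1" using unit[OF t01(1)] by (simp add: cinner_self)
    have cc: "c t * cnj (c t) = 1" using c[OF t01(1)] by (simp add: complex_norm_square[symmetric])
    have ft: "f t = c t *\<^sub>C g t" using c[OF t01(1)] by blast
    have "cinner f' (f t) *\<^sub>C f t
        = ((c t * cnj (c t)) * (c t * cinner g' (g t) + c')) *\<^sub>C g t"
      unfolding ft f' by (simp add: cinner_linear gg scaleC_scaleC algebra_simps)
    then have "f' - cinner f' (f t) *\<^sub>C f t = c t *\<^sub>C (g' - cinner g' (g t) *\<^sub>C g t)"
      by (simp add: cc f' scaleC_add_left scaleC_scaleC
        complex_vector.scale_right_diff_distrib)
    then have "norm (f' - cinner f' (f t) *\<^sub>C f t) = norm (g' - cinner g' (g t) *\<^sub>C g t)"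
      using c[OF t01(1)] by (simp add: norm_scaleC)
    then show "sqrt ((norm (velocity g t))\<^sup>2 - (cmod (cinner (velocity g t) (g t)))\<^sup>2)
        = sqrt ((norm (velocity f t))\<^sup>2 - (cmod (cinner (velocity f t) (f t)))\<^sup>2)"
      unfolding norm_orthogonal_part[OF unit(1)[OF t01(1)]] norm_orthogonal_part[OF unit(2)[OF t01(1)]]
        f'_def g'_def by simp
  qed
qed

lemma is_lift_proj_length: "is_lift \<sigma> \<gamma> \<Longrightarrow> proj_length \<gamma> = lift_length \<sigma>"
  unfolding proj_length_def
  by (rule lift_length_unique[OF someI[where P = "\<lambda>\<sigma>. is_lift \<sigma> \<gamma>"]])

text \<open>Common form of both minimizing curves: great circles have A = 0, and projections onto a
  rotating line are of this form with the doubled angle.\<close>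

definition trig_curve :: "real \<Rightarrow> 'a::real_normed_vector \<Rightarrow> 'a \<Rightarrow> 'a \<Rightarrow> real \<Rightarrow> 'a" where
  "trig_curve \<omega> A B C t = A + cos (\<omega> * t) *\<^sub>R B + sin (\<omega> * t) *\<^sub>R C"

lemma piecewise_smooth_trig_curve: "piecewise_smooth (trig_curve \<omega> A B C)"
proof -
  \<comment> \<open>Each derivative shifts the angle by a quarter turn and contributes a factor
    \<open>\<omega>\<close>; the constant A survives only at order 0.\<close>
  define \<phi> where "\<phi> n t = \<omega> * t + real n * (pi / 2)" for n :: nat and t :: real
  define K where "K n = (if n = 0 then A else 0)" for n :: nat
  define D where "D n t = K n
    + \<omega> ^ n *\<^sub>R (cos (\<phi> n t) *\<^sub>R B + sin (\<phi> n t) *\<^sub>R C)" for n :: nat and t :: real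
  have "(D n has_vector_derivative D (Suc n) t) (at t within {0..1})" for n t
  proof -
    have "((\<lambda>t. \<phi> n t) has_vector_derivative \<omega>) (at t within {0..1})"
      unfolding \<phi>_def by (auto intro!: derivative_eq_intros)
    then have \<phi>: "((\<lambda>t. \<phi> n t) has_real_derivative \<omega>) (at t within {0..1})"
      by (simp add: has_real_derivative_iff_has_vector_derivative)
    have suc: "\<phi> (Suc n) t = \<phi> n t + pi / 2" by (simp add: \<phi>_def algebra_simps)
    have "cos (\<phi> (Suc n) t) = - sin (\<phi> n t)" "sin (\<phi> (Suc n) t) = cos (\<phi> n t)"
      unfolding suc by (simp_all add: cos_add sin_add)
    then have D_Suc: "D (Suc n) t = \<omega> ^ n *\<^sub>R
        ((- sin (\<phi> n t) * \<omega>) *\<^sub>R B + (cos (\<phi> n t) * \<omega>) *\<^sub>R C)"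
      by (simp add: D_def K_def algebra_simps)
    show ?thesis
      unfolding D_Suc unfolding D_def by (auto intro!: derivative_eq_intros \<phi>)
  qed
  then have "smooth_on_interval (trig_curve \<omega> A B C) 0 1"
    unfolding smooth_on_interval_def
    by (intro exI[of _ D]) (simp add: D_def K_def \<phi>_def trig_curve_def)
  then show ?thesis
    unfolding piecewise_smooth_def by (intro exI[of _ 1] exI[of _ real]) simp
qed

lemma velocity_trig_curve:
  assumes "t \<in> {0..1}"
  shows "velocity (trig_curve \<omega> A B C) t
    = \<omega> *\<^sub>R (cos (\<omega> * t) *\<^sub>R C - sin (\<omega> * t) *\<^sub>R B)"
proof -
  have "((\<lambda>t. A + cos (\<omega> * t) *\<^sub>R B + sin (\<omega> * t) *\<^sub>R C) has_vector_derivative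
      \<omega> *\<^sub>R (cos (\<omega> * t) *\<^sub>R C - sin (\<omega> * t) *\<^sub>R B)) (at t within {0..1})"
    by (auto intro!: derivative_eq_intros simp: algebra_simps)
  then show ?thesis
    using vector_derivative_within_cbox[of 0 1 t] assms unfolding trig_curve_def by auto
qed

section \<open>The plane spanned by an orthonormal pair\<close>

text \<open>Resolves the definite description: two candidates are compared by pairing their
  difference with itself.\<close>

lemma cadjoint_eq:
  fixes T S :: "'h::complex_hilbert_space \<Rightarrow>\<^sub>L 'h"
  assumes "\<And>x y. cinner (blinfun_apply T x) y = cinner x (blinfun_apply S y)"
  shows "cadjoint T = S"
  unfolding cadjoint_def
proof (rule the_equality)
  fix S' :: "'h \<Rightarrow>\<^sub>L 'h" assume S': "\<forall>x y. cinner (T x) y = cinner x (S' y)"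
  have "S' y = S y" for y
  proof -
    have "cinner (S' y - S y) (S' y - S y) = 0"
      using S' assms[of "S' y - S y" y] by (simp add: cinner_linear)
    then show ?thesis by (simp add: cinner_self)
  qed
  then show "S' = S" by (rule blinfun_eqI)
qed (use assms in blast)

locale orthonormal_pair =
  fixes e u :: "'h::complex_hilbert_space"
  assumes norm_e: "norm e = 1" and norm_u: "norm u = 1" and orthogonal: "cinner e u = 0"
begin

lemma cinner_pair [simp]: "cinner e e = 1" "cinner u u = 1" "cinner e u = 0" "cinner u e = 0"
  using norm_e norm_u orthogonal cinner_commute[of u e] by (simp_all add: cinner_self)

lemma norm_combination: "(norm (\<alpha> *\<^sub>C e + \<beta> *\<^sub>C u))\<^sup>2 = (cmod \<alpha>)\<^sup>2 + (cmod \<beta>)\<^sup>2"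
  using norm_add_orthogonal[of "\<alpha> *\<^sub>C e" "\<beta> *\<^sub>C u"]
  by (simp add: cinner_linear norm_scaleC norm_e norm_u)

lemma Bessel: "(cmod (cinner x e))\<^sup>2 + (cmod (cinner x u))\<^sup>2 \<le> (norm x)\<^sup>2"
proof -
  let ?p = "cinner x e *\<^sub>C e + cinner x u *\<^sub>C u"
  have "cinner (x - ?p) ?p = 0" by (simp add: cinner_linear)
  from norm_add_orthogonal[OF this] show ?thesis
    by (simp add: norm_combination)
qed

text \<open>The great circle from \<open>e\<close> towards \<open>u\<close>, parametrized by arc
  length.\<close>

definition geodesic :: "real \<Rightarrow> 'h" where
  "geodesic \<phi> = cos \<phi> *\<^sub>R e + sin \<phi> *\<^sub>R u"

lemma norm_geodesic: "norm (geodesic \<phi>) = 1"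
proof -
  have "(norm (geodesic \<phi>))\<^sup>2 = 1"
    unfolding geodesic_def scaleR_eq_scaleC norm_combination by simp
  then show ?thesis by (simp add: power2_eq_1_iff) (metis norm_ge_zero not_one_le_zero neg_0_le_iff_le)
qed

text \<open>The reflection of the plane spanned by \<open>e\<close> and \<open>u\<close> with matrix
  \<open>[[- sin \<phi>, cos \<phi>], [cos \<phi>, sin \<phi>]]\<close>, extended by 0 to the orthogonal complement.\<close>

definition reflection :: "real \<Rightarrow> 'h \<Rightarrow>\<^sub>L 'h" where
  "reflection \<phi> = cos \<phi> *\<^sub>R (dyad e u + dyad u e) - sin \<phi> *\<^sub>R (dyad e e - dyad u u)"

lemma reflection_apply: "reflection \<phi> x =
    (of_real (cos \<phi>) * cinner x u - of_real (sin \<phi>) * cinner x e) *\<^sub>C e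
    + (of_real (cos \<phi>) * cinner x e + of_real (sin \<phi>) * cinner x u) *\<^sub>C u"
  by (simp add: reflection_def blinfun.add_left blinfun.diff_left blinfun.scaleR_left
      scaleR_eq_scaleC scaleC_scaleC scaleC_add_left scaleC_add_right
      complex_vector.scale_left_diff_distrib complex_vector.scale_right_diff_distrib)

text \<open>The matrix is real orthogonal, so it preserves the sums of squares of the real and of
  the imaginary parts of the coordinates separately.\<close>

lemma norm_reflection: "(norm (reflection \<phi> x))\<^sup>2 = (cmod (cinner x e))\<^sup>2 + (cmod (cinner x u))\<^sup>2"
proof -
  have rot: "(c * b - s * a)\<^sup>2 + (c * a + s * b)\<^sup>2 = a\<^sup>2 + b\<^sup>2" if "c\<^sup>2 + s\<^sup>2 = 1" for a b c s :: real
  proof -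
    have "(c * b - s * a)\<^sup>2 + (c * a + s * b)\<^sup>2 = (c\<^sup>2 + s\<^sup>2) * (a\<^sup>2 + b\<^sup>2)" by algebra
    then show ?thesis using that by simp
  qed
  show ?thesis
    unfolding reflection_apply norm_combination
    using rot[of "cos \<phi>" "sin \<phi>" "Re (cinner x u)" "Re (cinner x e)"]
      rot[of "cos \<phi>" "sin \<phi>" "Im (cinner x u)" "Im (cinner x e)"]
    by (simp add: cmod_power2)
qed

lemma norm_reflection_le: "norm (reflection \<phi>) \<le> 1"
proof (rule norm_blinfun_bound)
  show "norm (reflection \<phi> x) \<le> 1 * norm x" for x
    using norm_reflection[of \<phi> x] Bessel[of x] by (simp add: power2_le_imp_le)
qed simp

text \<open>The matrix squares to the identity, so the operator squares to the orthogonal projection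
  onto the plane.\<close>

lemma reflection_reflection: "reflection \<phi> (reflection \<phi> x) = cinner x e *\<^sub>C e + cinner x u *\<^sub>C u"
proof -
  have rot: "c * (c * a + s * b) - s * (c * b - s * a) = a" "c * (c * b - s * a) + s * (c * a + s * b) = b"
    if "c * c + s * s = 1" for a b c s :: complex
  proof -
    have "c * (c * a + s * b) - s * (c * b - s * a) = (c * c + s * s) * a" by algebra
    moreover have "c * (c * b - s * a) + s * (c * a + s * b) = (c * c + s * s) * b" by algebra
    ultimately show "c * (c * a + s * b) - s * (c * b - s * a) = a"
      "c * (c * b - s * a) + s * (c * a + s * b) = b" using that by simp_all
  qed
  have "complex_of_real (cos \<phi>) * of_real (cos \<phi>) + of_real (sin \<phi>) * of_real (sin \<phi>) = 1"
    by (metis of_real_1 of_real_add of_real_mult power2_eq_square sin_cos_squared_add2)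
  note rot = rot[OF this]
  have "cinner (reflection \<phi> x) e = of_real (cos \<phi>) * cinner x u - of_real (sin \<phi>) * cinner x e"
    "cinner (reflection \<phi> x) u = of_real (cos \<phi>) * cinner x e + of_real (sin \<phi>) * cinner x u"
    by (simp_all add: reflection_apply cinner_linear)
  then show ?thesis
    unfolding reflection_apply[of _ "reflection \<phi> x"] by (simp only: rot)
qed

lemma reflection_selfadjoint: "cinner (reflection \<phi> x) y = cinner x (reflection \<phi> y)"
proof -
  have ec: "cnj (cinner y e) = cinner e y" "cnj (cinner y u) = cinner u y"
    using cinner_commute[of e y] cinner_commute[of u y] by simp_all
  show ?thesis by (simp add: reflection_apply cinner_linear ec algebra_simps)
qed

text \<open>In the basis \<open>e\<close>, \<open>u\<close> the difference has rows (cos^2 - 1, sin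
  cos) and (sin cos, sin^2), from which sin factors out. It is also the difference of the
  projections onto the two orthogonal hyperplanes, taken in the opposite order.\<close>

lemma dyad_geodesic_diff:
  "dyad (geodesic \<phi>) (geodesic \<phi>) - dyad e e = sin \<phi> *\<^sub>R reflection \<phi>"
proof (rule blinfun_eqI)
  fix x
  have split: "\<alpha> *\<^sub>C e + \<beta> *\<^sub>C u = \<gamma> *\<^sub>C e + \<delta> *\<^sub>C u" if "\<alpha> = \<gamma>" "\<beta> = \<delta>" for \<alpha> \<beta> \<gamma> \<delta>
    using that by simp
  let ?c = "complex_of_real (cos \<phi>)" and ?s = "complex_of_real (sin \<phi>)"
  have one: "?c * ?c = 1 - ?s * ?s"
    by (metis of_real_1 of_real_diff of_real_mult power2_eq_square cos_squared_eq)
  have "(dyad (geodesic \<phi>) (geodesic \<phi>) - dyad e e) x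
      = (?c * (?c * cinner x e + ?s * cinner x u) - cinner x e) *\<^sub>C e
        + (?s * (?c * cinner x e + ?s * cinner x u)) *\<^sub>C u"
    by (simp add: blinfun.diff_left geodesic_def cinner_linear scaleR_eq_scaleC scaleC_add_right
      scaleC_scaleC complex_vector.scale_left_diff_distrib ac_simps)
  also have "\<dots> = (?s * (?c * cinner x u - ?s * cinner x e)) *\<^sub>C e
      + (?s * (?c * cinner x e + ?s * cinner x u)) *\<^sub>C u"
    by (rule split) (use one in algebra, rule refl)
  also have "\<dots> = (sin \<phi> *\<^sub>R reflection \<phi>) x"
    by (simp add: blinfun.scaleR_left reflection_apply scaleR_eq_scaleC scaleC_add_right scaleC_scaleC)
  finally show "(dyad (geodesic \<phi>) (geodesic \<phi>) - dyad e e) x = (sin \<phi> *\<^sub>R reflection \<phi>) x" .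
qed

text \<open>The bound from Bessel's inequality is attained at \<open>e\<close>. This gives both the
  operator norm in the theorem and the constant speed of the minimizing curve of
  projections.\<close>

lemma norm_scaled_reflection:
  assumes "0 \<le> s"
  shows "norm (s *\<^sub>R reflection \<phi>) = s"
proof -
  have "(norm (reflection \<phi> e))\<^sup>2 = 1" unfolding norm_reflection by simp
  then have "norm (reflection \<phi> e) = 1"
    by (simp add: power2_eq_1_iff) (metis norm_ge_zero not_one_le_zero neg_0_le_iff_le)
  then have "norm (reflection \<phi>) \<ge> 1"
    using norm_blinfun[of "reflection \<phi>" e] norm_e by simp
  then show ?thesis using norm_reflection_le[of \<phi>] assms by simp
qed

text \<open>The range lies in a plane: the unit ball is mapped into the image \<open>K\<close> of a
  product of two closed discs of coordinates.\<close>

lemma compact_scaled_reflection: "compact_operator (s *\<^sub>R reflection \<phi>)"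
proof -
  define T where "T = s *\<^sub>R reflection \<phi>"
  have lin: "complex_linear T"
    unfolding complex_linear_def
    by (simp add: T_def blinfun.scaleR_left reflection_apply cinner_linear scaleR_eq_scaleC
      scaleC_add_right scaleC_scaleC algebra_simps)
  define K where "K = (\<lambda>(\<alpha>, \<beta>). \<alpha> *\<^sub>C e + \<beta> *\<^sub>C u) ` (cball (0::complex) (norm T) \<times> cball (0::complex) (norm T))"
  have "compact K"
    unfolding K_def split_beta
    by (intro compact_continuous_image compact_Times compact_cball continuous_intros
      bounded_bilinear.continuous_on[OF bounded_bilinear_scaleC])
  moreover have "T ` cball 0 1 \<subseteq> K"
  proof safe
    fix x :: 'h assume "x \<in> cball 0 1"
    then have x: "norm (T x) \<le> norm T"
      using norm_blinfun[of T x] mult_left_mono[of "norm x" 1 "norm T"] by simp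
    have "cmod (cinner (T x) e) \<le> norm T" "cmod (cinner (T x) u) \<le> norm T"
      using cinner_Cauchy_Schwarz[of "T x" e] cinner_Cauchy_Schwarz[of "T x" u] x norm_e norm_u by auto
    moreover have "T x = cinner (T x) e *\<^sub>C e + cinner (T x) u *\<^sub>C u"
      by (simp add: T_def blinfun.scaleR_left reflection_apply cinner_linear scaleR_eq_scaleC
        scaleC_add_right scaleC_scaleC)
    ultimately show "T x \<in> K"
      unfolding K_def by (intro image_eqI[of _ _ "(cinner (T x) e, cinner (T x) u)"]) auto
  qed
  ultimately have "closure (T ` cball 0 1) \<subseteq> K"
    by (intro closure_minimal compact_imp_closed)
  with \<open>compact K\<close> have "compact (closure (T ` cball 0 1))"
    using compact_Int_closed[of K "closure (T ` cball 0 1)"] by (simp add: inf_absorb2)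
  with lin show ?thesis unfolding compact_operator_def T_def by blast
qed

section \<open>Singular values and Schatten norms\<close>

lemma cdim_pair: "cdim (cspan {e, u}) = 2"
proof -
  have "e \<notin> cspan {u}"
  proof
    assume "e \<in> cspan {u}"
    then obtain c where "e = c *\<^sub>C u" by (auto simp: complex_vector.span_singleton)
    then have "cinner e e = c * cinner u e" by (simp only: cinner_scaleC_left)
    then show False by simp
  qed
  moreover have "u \<noteq> 0" using norm_u by auto
  ultimately have "\<not> cdependent {e, u}" "e \<noteq> u"
    by (auto simp: complex_vector.independent_insert intro: complex_vector.span_base)
  then show ?thesis
    by (simp add: complex_vector.dim_eq_card_independent)
qed

text \<open>Here \<open>T\<^sup>* T\<close> is s^2 times the projection onto the plane. Its
  eigenspace for s^2 > 0 is the plane; for any other r^2 > 0, pairing with \<open>e\<close> and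
  \<open>u\<close> kills both coordinates and then the vector.\<close>

lemma singular_multiplicity_scaled_reflection:
  assumes s: "0 \<le> s" and r: "0 < r"
  shows "singular_multiplicity (s *\<^sub>R reflection \<phi>) r = (if r = s then 2 else 0)"
proof -
  define V where "V = {x. s\<^sup>2 *\<^sub>R (cinner x e *\<^sub>C e + cinner x u *\<^sub>C u) = r\<^sup>2 *\<^sub>R x}"
  have "cadjoint (s *\<^sub>R reflection \<phi>) = s *\<^sub>R reflection \<phi>"
    by (rule cadjoint_eq) (simp add: blinfun.scaleR_left cinner_linear reflection_selfadjoint)
  then have mult: "singular_multiplicity (s *\<^sub>R reflection \<phi>) r = cdim V"
    by (simp add: singular_multiplicity_def V_def blinfun.scaleR_left blinfun.scaleR_right
      reflection_reflection power2_eq_square)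
  show ?thesis
  proof (cases "r = s")
    case True
    then have V: "V = {x. cinner x e *\<^sub>C e + cinner x u *\<^sub>C u = x}"
      using r by (simp add: V_def)
    have "cspan {e, u} = V"
    proof (rule complex_vector.span_subspace)
      show "{e, u} \<subseteq> V" by (simp add: V)
      show "V \<subseteq> cspan {e, u}"
      proof
        fix x assume "x \<in> V"
        then have "x = cinner x e *\<^sub>C e + cinner x u *\<^sub>C u" by (simp add: V)
        also have "\<dots> \<in> cspan {e, u}"
          by (intro complex_vector.span_add complex_vector.span_scale complex_vector.span_base) auto
        finally show "x \<in> cspan {e, u}" .
      qed
      show "complex_vector.subspace V"
        unfolding complex_vector.subspace_def V
      proof safe
        fix x y assume "cinner x e *\<^sub>C e + cinner x u *\<^sub>C u = x" "cinner y e *\<^sub>C e + cinner y u *\<^sub>C u = y"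
        from arg_cong2[OF this, of "(+)"]
        show "cinner (x + y) e *\<^sub>C e + cinner (x + y) u *\<^sub>C u = x + y"
          by (simp add: cinner_add_left scaleC_add_left algebra_simps)
      next
        fix c x assume "cinner x e *\<^sub>C e + cinner x u *\<^sub>C u = x"
        from arg_cong[OF this, of "scaleC c"]
        show "cinner (c *\<^sub>C x) e *\<^sub>C e + cinner (c *\<^sub>C x) u *\<^sub>C u = c *\<^sub>C x"
          by (simp add: cinner_scaleC_left scaleC_add_right scaleC_scaleC)
      qed simp
    qed
    then show ?thesis using True mult cdim_pair by simp
  next
    case False
    then have neq: "complex_of_real (s\<^sup>2) \<noteq> of_real (r\<^sup>2)"
      using s r by (metis less_imp_le of_real_eq_iff power2_eq_iff_nonneg)
    have "x = 0" if "x \<in> V" for x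
    proof -
      have x: "s\<^sup>2 *\<^sub>R (cinner x e *\<^sub>C e + cinner x u *\<^sub>C u) = r\<^sup>2 *\<^sub>R x"
        using that by (simp add: V_def)
      have "of_real (s\<^sup>2) * cinner x e = of_real (r\<^sup>2) * cinner x e"
        using arg_cong[OF x, of "\<lambda>x. cinner x e"] by (simp add: cinner_linear)
      moreover have "of_real (s\<^sup>2) * cinner x u = of_real (r\<^sup>2) * cinner x u"
        using arg_cong[OF x, of "\<lambda>x. cinner x u"] by (simp add: cinner_linear)
      ultimately have "cinner x e = 0" "cinner x u = 0"
        using neq mult_right_cancel by blast+
      then show ?thesis using x r by simp
    qed
    moreover have "0 \<in> V" by (simp add: V_def)
    ultimately have "V = cspan {}" by auto
    then show ?thesis
      using False mult complex_vector.dim_span[of "{} :: 'h set"]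
        complex_vector.dim_eq_card_independent[of "{} :: 'h set"]
      by (simp add: complex_vector.independent_empty)
  qed
qed

lemma scaled_reflection_schatten:
  assumes s: "0 \<le> s" and p: "1 \<le> p"
  shows "s *\<^sub>R reflection \<phi> \<in> schatten_class p"
    and "schatten_norm p (s *\<^sub>R reflection \<phi>) = 2 powr (1 / p) * s"
proof -
  let ?f = "\<lambda>r. real (singular_multiplicity (s *\<^sub>R reflection \<phi>) r) * r powr p"
  have "(?f has_sum (\<Sum>r\<in>{s} \<inter> {0<..}. ?f r)) ({s} \<inter> {0<..})" by (intro has_sum_finite) simp
  also have "(\<Sum>r\<in>{s} \<inter> {0<..}. ?f r) = 2 * s powr p"
    \<comment> \<open>For s = 0 the index set is empty, and 0 \<open>powr\<close> p is 0 as
      well.\<close>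
    using s p by (cases "s = 0") (auto simp: singular_multiplicity_scaled_reflection)
  also have "(?f has_sum 2 * s powr p) ({s} \<inter> {0<..}) \<longleftrightarrow> (?f has_sum 2 * s powr p) {0<..}"
    by (rule has_sum_cong_neutral) (use s in \<open>auto simp: singular_multiplicity_scaled_reflection\<close>)
  finally have sum: "(?f has_sum 2 * s powr p) {0<..}" .
  show "s *\<^sub>R reflection \<phi> \<in> schatten_class p"
    unfolding schatten_class_def using sum compact_scaled_reflection has_sum_imp_summable by blast
  have "schatten_norm p (s *\<^sub>R reflection \<phi>) = (2 * s powr p) powr (1 / p)"
    unfolding schatten_norm_def infsumI[OF sum] ..
  also have "\<dots> = 2 powr (1 / p) * s"
    using s p by (simp add: powr_mult powr_powr)
  finally show "schatten_norm p (s *\<^sub>R reflection \<phi>) = 2 powr (1 / p) * s" .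
qed

text \<open>Projecting along the rotating line gives a curve of constant speed
  \<open>\<theta>\<close>, and \<open>grassmann_length_lower_bound\<close> shows that none is
  shorter.\<close>

lemma grassmann_dist_geodesic:
  assumes \<theta>: "0 \<le> \<theta>" "\<theta> \<le> pi / 2"
  shows "grassmann_dist {f. cinner f e = 0} {f. cinner f (geodesic \<theta>) = 0} = \<theta>"
proof -
  define C where "C = grassmann_curves {f. cinner f e = 0} {f. cinner f (geodesic \<theta>) = 0}"
  \<comment> \<open>By the half-angle formulas, the projection onto the line at angle
    \<open>\<phi>\<close> is half of the projection onto the plane plus terms in cos and sin of 2
    \<open>\<phi>\<close>; \<open>g\<close> is its complement.\<close>
  define g where "g = trig_curve (2 * \<theta>) (id_blinfun - (1/2) *\<^sub>R (dyad e e + dyad u u))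
    ((1/2) *\<^sub>R (dyad u u - dyad e e)) (- (1/2) *\<^sub>R (dyad e u + dyad u e))"
  have g: "g t = id_blinfun - dyad (geodesic (\<theta> * t)) (geodesic (\<theta> * t))" for t
  proof (rule blinfun_eqI)
    fix x
    let ?c = "complex_of_real (cos (\<theta> * t))" and ?s = "complex_of_real (sin (\<theta> * t))"
    have double: "2 * \<theta> * t = 2 * (\<theta> * t)" by simp
    have split: "x - (\<alpha> *\<^sub>C e + \<beta> *\<^sub>C u) = x - (\<gamma> *\<^sub>C e + \<delta> *\<^sub>C u)" if "\<alpha> = \<gamma>" "\<beta> = \<delta>" for \<alpha> \<beta> \<gamma> \<delta>
      using that by simp
    have one: "?s * ?s = 1 - ?c * ?c"
      by (metis of_real_1 of_real_diff of_real_mult power2_eq_square sin_squared_eq)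
    have "g t x = x - (
        (1/2 * (cinner x e + (?c * ?c - ?s * ?s) * cinner x e + 2 * ?s * ?c * cinner x u)) *\<^sub>C e
        + (1/2 * (cinner x u - (?c * ?c - ?s * ?s) * cinner x u + 2 * ?s * ?c * cinner x e)) *\<^sub>C u)"
      unfolding g_def trig_curve_def double cos_double sin_double
      by (simp add: blinfun.add_left blinfun.diff_left blinfun.minus_left blinfun.scaleR_left
          scaleR_eq_scaleC scaleC_scaleC scaleC_add_left scaleC_add_right algebra_simps
          complex_vector.scale_left_diff_distrib complex_vector.scale_right_diff_distrib
          power2_eq_square)
    also have "\<dots> = x - ((?c * (?c * cinner x e + ?s * cinner x u)) *\<^sub>C e
        + (?s * (?c * cinner x e + ?s * cinner x u)) *\<^sub>C u)"
      by (rule split) (simp_all add: one algebra_simps)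
    also have "\<dots> = (id_blinfun - dyad (geodesic (\<theta> * t)) (geodesic (\<theta> * t))) x"
      by (simp add: blinfun.diff_left geodesic_def cinner_linear scaleR_eq_scaleC scaleC_add_right
        scaleC_scaleC ac_simps)
    finally show "g t x = (id_blinfun - dyad (geodesic (\<theta> * t)) (geodesic (\<theta> * t))) x" .
  qed
  have "velocity g t = - \<theta> *\<^sub>R reflection (2 * \<theta> * t)" if "t \<in> {0..1}" for t
    unfolding g_def velocity_trig_curve[OF that] reflection_def
    by (simp add: algebra_simps)
  then have speed: "norm (velocity g t) = \<theta>" if "t \<in> {0..1}" for t
    using norm_scaled_reflection[OF \<theta>(1), of "2 * \<theta> * t"] that by simp
  have "grassmann_length g = integral {0..1} (\<lambda>t::real. \<theta>)"
    unfolding grassmann_length_def by (rule integral_cong) (use speed in auto)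
  then have length: "grassmann_length g = \<theta>" by simp
  have "g \<in> C"
    unfolding C_def grassmann_curves_def
    using projection_onto_hyperplane[OF norm_e] projection_onto_hyperplane[OF norm_geodesic[of \<theta>]]
      orthogonal_projection_hyperplane(1)[OF norm_geodesic] g[of 0] g[of 1]
    by (simp add: g grassmannian_def) (simp add: g_def piecewise_smooth_trig_curve geodesic_def)
  moreover have "\<theta> \<le> grassmann_length h" if "h \<in> C" for h
  proof -
    have h: "piecewise_smooth h" "\<And>t. t \<in> {0..1} \<Longrightarrow> h t \<in> grassmannian"
      "h 0 = id_blinfun - dyad e e" "h 1 = id_blinfun - dyad (geodesic \<theta>) (geodesic \<theta>)"
      using that projection_onto_hyperplane[OF norm_e] projection_onto_hyperplane[OF norm_geodesic[of \<theta>]]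
      by (auto simp: C_def grassmann_curves_def)
    have "inner (2 *\<^sub>R h 0 e - e) e = - 1"
      by (simp add: h blinfun.diff_left inner_eq_Re_cinner cinner_minus_left)
    moreover have "inner (2 *\<^sub>R h 1 e - e) e = - cos (2 * \<theta>)"
      by (simp add: h blinfun.diff_left inner_eq_Re_cinner cinner_linear geodesic_def
        cos_double_cos power2_eq_square)
    \<comment> \<open>Together with arccos (-1) = pi at the start, the variation is 2
      \<open>\<theta>\<close>; the bound pi/2 keeps this angle in the range of
      \<open>arccos\<close>.\<close>
    moreover have "arccos (- cos (2 * \<theta>)) = pi - 2 * \<theta>"
      using \<theta> by (simp add: arccos_minus arccos_cos)
    ultimately show ?thesis
      using grassmann_length_lower_bound[OF h(1,2) norm_e] \<theta> by simp
  qed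
  ultimately show ?thesis
    unfolding grassmann_dist_def C_def[symmetric]
    by (intro cInf_eq_minimum) (use length in auto)
qed

text \<open>The great circle itself is a lift of length \<open>\<theta>\<close>;
  \<open>lift_length_lower_bound\<close> shows that it is minimal.\<close>

lemma proj_dist_geodesic:
  assumes \<theta>: "0 \<le> \<theta>" "\<theta> \<le> pi / 2"
  shows "(INF \<gamma>\<in>proj_curves (proj_class e) (proj_class (geodesic \<theta>)). proj_length \<gamma>) = \<theta>"
proof -
  define g where "g = trig_curve \<theta> 0 e u"
  have g: "g t = geodesic (\<theta> * t)" for t
    by (simp add: g_def trig_curve_def geodesic_def)
  have lift: "is_lift g (\<lambda>t. proj_class (g t))"
    unfolding is_lift_def using norm_geodesic by (simp add: g) (simp add: g_def piecewise_smooth_trig_curve)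
  have "sqrt ((norm (velocity g t))\<^sup>2 - (cmod (cinner (velocity g t) (g t)))\<^sup>2) = \<theta>"
    if "t \<in> {0..1}" for t
  proof -
    have v: "velocity g t = of_real (- \<theta> * sin (\<theta> * t)) *\<^sub>C e + of_real (\<theta> * cos (\<theta> * t)) *\<^sub>C u"
      unfolding g_def velocity_trig_curve[OF that]
      by (simp add: scaleR_eq_scaleC scaleC_scaleC complex_vector.scale_right_diff_distrib)
    have "(norm (velocity g t))\<^sup>2 = \<theta>\<^sup>2 * ((sin (\<theta> * t))\<^sup>2 + (cos (\<theta> * t))\<^sup>2)"
      unfolding v norm_combination
      by (simp add: norm_mult power_mult_distrib flip: distrib_left)
    \<comment> \<open>The great circle is horizontal, so its whole speed counts.\<close>
    moreover have "cinner (velocity g t) (g t) = 0"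
      unfolding v g geodesic_def by (simp add: cinner_linear)
    ultimately show ?thesis using \<theta> by simp
  qed
  then have "lift_length g = integral {0..1} (\<lambda>t::real. \<theta>)"
    unfolding lift_length_def by (intro integral_cong) auto
  then have length: "proj_length (\<lambda>t. proj_class (g t)) = \<theta>"
    using is_lift_proj_length[OF lift] by simp
  have "proj_class (g t) \<in> projective_space" for t
    unfolding projective_space_def proj_class_def
    by (rule quotientI) (simp add: g norm_geodesic)
  then have "(\<lambda>t. proj_class (g t)) \<in> proj_curves (proj_class e) (proj_class (geodesic \<theta>))"
    using lift g[of 0] g[of 1] unfolding proj_curves_def piecewise_smooth_proj_def
    by (auto simp: geodesic_def)
  moreover have "\<theta> \<le> proj_length \<gamma>"
    if \<gamma>: "\<gamma> \<in> proj_curves (proj_class e) (proj_class (geodesic \<theta>))" for \<gamma>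
  proof -
    obtain \<sigma> where \<sigma>: "is_lift \<sigma> \<gamma>" "\<gamma> 0 = proj_class e" "\<gamma> 1 = proj_class (geodesic \<theta>)"
      using \<gamma> unfolding proj_curves_def piecewise_smooth_proj_def by blast
    then have unit: "\<And>t. t \<in> {0..1} \<Longrightarrow> norm (\<sigma> t) = 1"
      and ends: "proj_class (\<sigma> 0) = proj_class e" "proj_class (\<sigma> 1) = proj_class (geodesic \<theta>)"
      by (auto simp: is_lift_def)
    obtain c d where "cmod c = 1" "\<sigma> 0 = c *\<^sub>C e" "cmod d = 1" "\<sigma> 1 = d *\<^sub>C geodesic \<theta>"
      using proj_class_eqD ends unit[of 0] unit[of 1] norm_e norm_geodesic
      by (metis atLeastAtMost_iff order.refl zero_le_one)
    \<comment> \<open>The modulus removes the phases of the end points, and the cosine is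
      nonnegative on the given range.\<close>
    then have "cmod (cinner (\<sigma> 0) (\<sigma> 1)) = cos \<theta>"
      using \<theta> cos_ge_zero[of \<theta>] by (simp add: cinner_linear norm_mult geodesic_def)
    then show ?thesis
      using lift_length_lower_bound[of \<sigma>] unit \<sigma>(1) is_lift_proj_length[OF \<sigma>(1)] \<theta>
      by (simp add: is_lift_def arccos_cos)
  qed
  ultimately show ?thesis
    by (intro cInf_eq_minimum) (use length in auto)
qed

end

section \<open>Transfer to kernels and their zero spaces\<close>

theorem theorem3p2:
  fixes ev :: "'h::complex_hilbert_space \<Rightarrow> 'x \<Rightarrow> complex"
    and k :: "'x \<Rightarrow> 'h"
    and a b :: 'x
  assumes rkhs: "rkhs ev k"
    and infinite_dim: "\<not> (\<exists>B :: 'h set. finite B \<and> cspan B = UNIV)"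
    and kernel_nonzero: "\<And>x. k x \<noteq> 0"
    and kernels_independent: "\<And>x y. x \<noteq> y \<Longrightarrow> k x \<noteq> k y \<and> \<not> cdependent {k x, k y}"
  shows "delta_check k a b = Gamma_dist ev a b
    \<and> (delta k a b = sin (Gamma_dist ev a b)
       \<and> sin (Gamma_dist ev a b)
           = norm (projection_onto (zero_space ev a) - projection_onto (zero_space ev b))
       \<and> (\<forall>p::real. 1 \<le> p \<longrightarrow>
            projection_onto (zero_space ev a) - projection_onto (zero_space ev b) \<in> schatten_class p
            \<and> norm (projection_onto (zero_space ev a) - projection_onto (zero_space ev b))
              = 2 powr (- 1 / p)
                * schatten_norm p
                    (projection_onto (zero_space ev a) - projection_onto (zero_space ev b))))
    \<and> delta_hat k a b = sqrt 2 * sin (Gamma_dist ev a b / 2)"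
proof -
  define e where "e = k a /\<^sub>R norm (k a)"
  define f where "f = k b /\<^sub>R norm (k b)"
  have e: "norm e = 1" and f: "norm f = 1"
    using kernel_nonzero by (simp_all add: e_def f_def)
  \<comment> \<open>The angle between the complex lines of the two kernels, to which both distances
    turn out to be equal; it is 0 when a = b.\<close>
  define \<theta> where "\<theta> = arccos (cmod (cinner e f))"
  have c: "0 \<le> cmod (cinner e f)" "cmod (cinner e f) \<le> 1" "- 1 \<le> cmod (cinner e f)"
    using unit_cinner_le_1[OF e f] order_trans[OF _ norm_ge_zero, of "- 1"] by auto
  have \<theta>: "0 \<le> \<theta>" "\<theta> \<le> pi / 2" "cos \<theta> = cmod (cinner e f)"
    using c arccos_lbound[of "cmod (cinner e f)"] arccos_le_pi2[of "cmod (cinner e f)"]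
      cos_arccos[of "cmod (cinner e f)"] by (simp_all add: \<theta>_def)
  have sin: "sin \<theta> = sqrt (1 - (cmod (cinner e f))\<^sup>2)"
    using c by (simp add: \<theta>_def sin_arccos)
  obtain u z where u: "norm u = 1" "cinner e u = 0" and z: "cmod z = 1"
    and fz: "f = z *\<^sub>C (cos \<theta> *\<^sub>R e + sin \<theta> *\<^sub>R u)"
    using polar_decomposition[OF infinite_dim e f] unfolding sin[symmetric] unfolding \<theta>(3)[symmetric] by metis
  interpret orthonormal_pair e u using e u by unfold_locales
  have fz: "f = z *\<^sub>C geodesic \<theta>" using fz by (simp add: geodesic_def)
  have zero_a: "zero_space ev a = {h. cinner h e = 0}"
    using rkhs kernel_nonzero by (simp add: zero_space_def rkhs_def e_def cinner_linear)
  have zero_b: "zero_space ev b = {h. cinner h (geodesic \<theta>) = 0}"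
  proof -
    have "zero_space ev b = {h. cinner h f = 0}"
      using rkhs kernel_nonzero by (simp add: zero_space_def rkhs_def f_def cinner_linear)
    \<comment> \<open>A phase does not change the orthogonal complement, so \<open>f\<close> may be
      replaced by the point of the great circle.\<close>
    also have "\<dots> = {h. cinner h (geodesic \<theta>) = 0}"
      using z by (auto simp: fz cinner_linear)
    finally show ?thesis .
  qed
  have Gamma: "Gamma_dist ev a b = \<theta>"
    unfolding Gamma_dist_def zero_a zero_b by (rule grassmann_dist_geodesic[OF \<theta>(1,2)])
  have "delta_check k a b = \<theta>"
    unfolding delta_check_def e_def[symmetric] f_def[symmetric] fz
      proj_class_phase[OF norm_geodesic z] by (rule proj_dist_geodesic[OF \<theta>(1,2)])
  moreover have ratio: "cmod (cinner (k a) (k b)) / (norm (k a) * norm (k b)) = cos \<theta>"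
    unfolding \<theta>(3) by (simp add: e_def f_def cinner_linear norm_mult norm_inverse norm_divide field_simps)
  moreover have "delta k a b = sin \<theta>"
    unfolding delta_def ratio sin \<theta>(3) ..
  moreover have "delta_hat k a b = sqrt 2 * sin (\<theta> / 2)"
  proof -
    have "1 - cos \<theta> = 2 * (sin (\<theta> / 2))\<^sup>2" using cos_double_sin[of "\<theta> / 2"] by simp
    moreover have "0 \<le> sin (\<theta> / 2)" using \<theta> by (intro sin_ge_zero) auto
    ultimately show ?thesis unfolding delta_hat_def ratio by (simp add: real_sqrt_mult)
  qed
  moreover have diff: "projection_onto (zero_space ev a) - projection_onto (zero_space ev b)
      = sin \<theta> *\<^sub>R reflection \<theta>"
    unfolding zero_a zero_b projection_onto_hyperplane[OF e] projection_onto_hyperplane[OF norm_geodesic]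
    using dyad_geodesic_diff[of \<theta>] by simp
  moreover have s: "0 \<le> sin \<theta>" using \<theta> by (intro sin_ge_zero) auto
  \<comment> \<open>The factor 2^(1/p) comes from the multiplicity two of the singular value; the
    normalization cancels it.\<close>
  moreover have "2 powr (- 1 / p) * (2 powr (1 / p) * sin \<theta>) = sin \<theta>" for p :: real
    by (simp add: powr_add[symmetric] mult.assoc[symmetric])
  ultimately show ?thesis
    unfolding Gamma diff norm_scaled_reflection[OF s]
    using scaled_reflection_schatten[OF s] by simp
qed

end
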